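(* Let $\mathfrak b=\mathcal K(\ell^2(\{\#\}\cup\mathbb Z))+\mathbb C I$ be the unital Boolean $C^*$-algebra. The compact convex set of symmetric states on $\mathfrak b$ is $$\mathcal S_{\mathbb P_{\mathbb Z}}(\mathfrak b)=\{\gamma\omega_\#+(1-\gamma)\omega_\infty\mid\gamma\in[0,1]\},$$ where $\omega_\#=\langle\,\cdot\,e_\#,e_\#\rangle$ is the Fock vacuum state and $\omega_\infty(A+aI):=a$ for $A\in\mathcal K(\ell^2(\{\#\}\cup\mathbb Z))$, $a\in\mathbb C$.
   Context: $\ell^2(\{\#\}\cup\mathbb Z)$ has canonical orthonormal basis $\{e_\#\}\cup\{e_i\mid i\in\mathbb Z\}$ (it is the Boolean Fock space $\mathbb C\oplus\ell^2(\mathbb Z)$ with vacuum vector $e_\#$), and $\mathcal K$ denotes the compact operators. $\mathbb P_{\mathbb Z}$ is the group of permutations of $\mathbb Z$ moving only finitely many elements. It acts on $\mathfrak b$ by $\alpha_g=\mathrm{Ad}(U_g)$, where $U_g$ is the unitary with $U_ge_\#=e_\#$, $U_ge_i=e_{g(i)}$, $i\in\mathbb Z$. A state $\omega$ is symmetric if $\omega\circ\alpha_g=\omega$ for all $g\in\mathbb P_{\mathbb Z}$. *)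

theory Defs
  imports "HOL-Analysis.Analysis" "HOL-Combinatorics.Perm"
begin

section \<open>The complex Hilbert space of square-summable families\<close>

typedef 'i ell2 = "{f :: 'i \<Rightarrow> complex. (\<lambda>i. (cmod (f i))\<^sup>2) summable_on UNIV}"
  morphisms coord Abs_ell2
  by (rule exI[of _ "\<lambda>_. 0"]) simp

setup_lifting type_definition_ell2

lemma ell2_eqI: "(\<And>i. coord x i = coord y i) \<Longrightarrow> x = y"
  by (simp add: coord_inject[symmetric] fun_eq_iff)

lemma square_summable_coord: "(\<lambda>i. (cmod (coord x i))\<^sup>2) summable_on UNIV"
  using coord[of x] by simp

lemma square_summable_add:
  fixes f g :: "'i \<Rightarrow> complex"
  assumes "(\<lambda>i. (cmod (f i))\<^sup>2) summable_on UNIV" "(\<lambda>i. (cmod (g i))\<^sup>2) summable_on UNIV"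
  shows "(\<lambda>i. (cmod (f i + g i))\<^sup>2) summable_on UNIV"
proof (rule summable_on_comparison_test)
  show "(\<lambda>i. 2 * (cmod (f i))\<^sup>2 + 2 * (cmod (g i))\<^sup>2) summable_on UNIV"
    by (intro summable_on_add summable_on_cmult_right assms)
  fix i
  have "(cmod (f i + g i))\<^sup>2 \<le> (cmod (f i) + cmod (g i))\<^sup>2"
    by (simp add: norm_triangle_ineq power_mono)
  also have "\<dots> \<le> 2 * (cmod (f i))\<^sup>2 + 2 * (cmod (g i))\<^sup>2"
    using zero_le_power2[of "cmod (f i) - cmod (g i)"] by (simp add: power2_eq_square algebra_simps)
  finally show "(cmod (f i + g i))\<^sup>2 \<le> 2 * (cmod (f i))\<^sup>2 + 2 * (cmod (g i))\<^sup>2" .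
qed simp

lemma square_summable_cmult:
  fixes f :: "'i \<Rightarrow> complex"
  assumes "(\<lambda>i. (cmod (f i))\<^sup>2) summable_on UNIV"
  shows "(\<lambda>i. (cmod (c * f i))\<^sup>2) summable_on UNIV"
  using summable_on_cmult_right[OF assms, of "(cmod c)\<^sup>2"] by (simp add: norm_mult power_mult_distrib)

lift_definition scaleC_ell2 :: "complex \<Rightarrow> 'i ell2 \<Rightarrow> 'i ell2" (infixr \<open>*\<^sub>C\<close> 75)
  is "\<lambda>c f i. c * f i"
  by (rule square_summable_cmult)

text \<open>The inner product is linear in its first argument.\<close>

definition cinner :: "'i ell2 \<Rightarrow> 'i ell2 \<Rightarrow> complex"
  where "cinner x y = (\<Sum>\<^sub>\<infinity>i. coord x i * cnj (coord y i))"

lemma cinner_summable: "(\<lambda>i. coord x i * cnj (coord y i)) summable_on UNIV"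
proof (rule abs_summable_summable, rule Infinite_Sum.abs_summable_on_comparison_test')
  show "(\<lambda>i. (cmod (coord x i))\<^sup>2 + (cmod (coord y i))\<^sup>2) summable_on UNIV"
    by (intro summable_on_add square_summable_coord)
  fix i
  have "2 * (cmod (coord x i) * cmod (coord y i)) \<le> (cmod (coord x i))\<^sup>2 + (cmod (coord y i))\<^sup>2"
    using zero_le_power2[of "cmod (coord x i) - cmod (coord y i)"]
    by (simp add: power2_eq_square algebra_simps)
  moreover have "0 \<le> cmod (coord x i) * cmod (coord y i)" by simp
  ultimately show "norm (coord x i * cnj (coord y i)) \<le> (cmod (coord x i))\<^sup>2 + (cmod (coord y i))\<^sup>2"
    unfolding norm_mult complex_mod_cnj by linarith
qed

instantiation ell2 :: (type) real_inner
begin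

lift_definition zero_ell2 :: "'a ell2" is "\<lambda>_. 0" by simp
lift_definition plus_ell2 :: "'a ell2 \<Rightarrow> 'a ell2 \<Rightarrow> 'a ell2" is "\<lambda>f g i. f i + g i"
  by (rule square_summable_add)
lift_definition uminus_ell2 :: "'a ell2 \<Rightarrow> 'a ell2" is "\<lambda>f i. - f i" by simp
definition minus_ell2 :: "'a ell2 \<Rightarrow> 'a ell2 \<Rightarrow> 'a ell2" where "x - y = x + - (y :: 'a ell2)"
definition scaleR_ell2 :: "real \<Rightarrow> 'a ell2 \<Rightarrow> 'a ell2" where "scaleR r x = complex_of_real r *\<^sub>C x"
definition inner_ell2 :: "'a ell2 \<Rightarrow> 'a ell2 \<Rightarrow> real" where "inner x y = Re (cinner x y)"
definition norm_ell2 :: "'a ell2 \<Rightarrow> real" where "norm x = sqrt (\<Sum>\<^sub>\<infinity>i. (cmod (coord x i))\<^sup>2)"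
definition dist_ell2 :: "'a ell2 \<Rightarrow> 'a ell2 \<Rightarrow> real" where "dist x y = norm (x - y :: 'a ell2)"
definition sgn_ell2 :: "'a ell2 \<Rightarrow> 'a ell2" where "sgn x = inverse (norm x) *\<^sub>R (x :: 'a ell2)"
definition uniformity_ell2 :: "('a ell2 \<times> 'a ell2) filter"
  where "uniformity_ell2 = (INF e\<in>{0<..}. principal {(x, y). dist x y < e})"
definition open_ell2 :: "'a ell2 set \<Rightarrow> bool"
  where "open_ell2 U \<longleftrightarrow> (\<forall>x\<in>U. eventually (\<lambda>(x', y). x' = x \<longrightarrow> y \<in> U) uniformity)"

lemma coord_simps_aux:
  "coord (0 :: 'a ell2) i = 0" "coord (x + y) i = coord x i + coord y i"
  "coord (- x) i = - coord x i" "coord (r *\<^sub>R x) i = complex_of_real r * coord x i"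
  by (simp_all add: zero_ell2.rep_eq plus_ell2.rep_eq uminus_ell2.rep_eq scaleR_ell2_def
      scaleC_ell2.rep_eq)

lemma inner_self_aux: "inner x x = (\<Sum>\<^sub>\<infinity>i. (cmod (coord x i))\<^sup>2)" for x :: "'a ell2"
  unfolding inner_ell2_def cinner_def
  by (subst infsum_Re[OF cinner_summable, symmetric]) (simp add: complex_mult_cnj cmod_power2)

instance
proof
  fix x y z :: "'a ell2" and r s :: real
  note s = coord_simps_aux minus_ell2_def
  show "x + y + z = x + (y + z)" "x + y = y + x" "0 + x = x" "- x + x = 0" "x - y = x + - y"
    "r *\<^sub>R (x + y) = r *\<^sub>R x + r *\<^sub>R y" "(r + s) *\<^sub>R x = r *\<^sub>R x + s *\<^sub>R x"
    "r *\<^sub>R s *\<^sub>R x = (r * s) *\<^sub>R x" "1 *\<^sub>R x = x"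
    by (rule ell2_eqI, simp add: s distrib_left distrib_right mult.assoc add.assoc add.left_commute add.commute)+
  show "dist x y = norm (x - y)" by (fact dist_ell2_def)
  show "sgn x = inverse (norm x) *\<^sub>R x" by (fact sgn_ell2_def)
  show "uniformity = (INF e\<in>{0<..}. principal {(x :: 'a ell2, y). dist x y < e})"
    by (fact uniformity_ell2_def)
  show "open U \<longleftrightarrow> (\<forall>x\<in>U. \<forall>\<^sub>F (x', y) in uniformity. x' = x \<longrightarrow> y \<in> U)" for U :: "'a ell2 set"
    by (fact open_ell2_def)
  have "cinner y x = cnj (cinner x y)"
    unfolding cinner_def by (subst infsum_cnj[symmetric]) (simp add: mult.commute)
  then show "inner x y = inner y x" by (simp add: inner_ell2_def)
  show "inner (x + y) z = inner x z + inner y z"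
    by (simp add: inner_ell2_def cinner_def s distrib_right infsum_add cinner_summable)
  show "inner (r *\<^sub>R x) y = r * inner x y"
    by (simp add: inner_ell2_def cinner_def s mult.assoc infsum_cmult_right')
  show "0 \<le> inner x x" by (simp add: inner_self_aux infsum_nonneg)
  show "norm x = sqrt (inner x x)" by (simp add: inner_self_aux norm_ell2_def)
  show "inner x x = 0 \<longleftrightarrow> x = 0"
  proof
    assume "inner x x = 0"
    then have "(cmod (coord x i))\<^sup>2 = 0" for i
      by (intro nonneg_infsum_le_0D[of "\<lambda>i. (cmod (coord x i))\<^sup>2" UNIV])
        (auto simp: inner_self_aux square_summable_coord)
    then show "x = 0" by (intro ell2_eqI) (simp add: s)
  qed (simp add: inner_self_aux s)
qed

end

lemmas coord_simps [simp] = coord_simps_aux scaleC_ell2.rep_eq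

lift_definition basis_vec :: "'i \<Rightarrow> 'i ell2" is "\<lambda>k i. if i = k then 1 else 0"
proof -
  fix k :: 'i
  have "(\<lambda>i. (cmod (if i = k then 1 else 0))\<^sup>2) summable_on {k}" by simp
  then show "(\<lambda>i. (cmod (if i = k then 1 else 0))\<^sup>2) summable_on UNIV"
    by (rule summable_on_cong_neutral[THEN iffD1, rotated -1]) auto
qed

section \<open>Operators\<close>

definition bounded_clinear_op :: "('i ell2 \<Rightarrow> 'i ell2) \<Rightarrow> bool"
  where "bounded_clinear_op T \<longleftrightarrow> bounded_linear T \<and> (\<forall>c x. T (c *\<^sub>C x) = c *\<^sub>C T x)"

definition compact_op :: "('i ell2 \<Rightarrow> 'i ell2) \<Rightarrow> bool"
  where "compact_op T \<longleftrightarrow> bounded_clinear_op T \<and> compact (closure (T ` cball 0 1))"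

text \<open>The adjoint is unique by \<open>adj_eqI\<close> below; it exists for every bounded operator.\<close>

definition adj :: "('i ell2 \<Rightarrow> 'i ell2) \<Rightarrow> 'i ell2 \<Rightarrow> 'i ell2"
  where "adj T = (THE S. \<forall>x y. cinner (T x) y = cinner x (S y))"

lemma cinner_basis_vec: "cinner (basis_vec k) x = cnj (coord x k)"
proof -
  have "cinner (basis_vec k) x = (\<Sum>\<^sub>\<infinity>i\<in>{k}. cnj (coord x i))"
    unfolding cinner_def basis_vec.rep_eq by (rule infsum_cong_neutral) auto
  then show ?thesis by simp
qed

lemma adj_eqI:
  assumes "\<And>x y. cinner (T x) y = cinner x (S y)"
  shows "adj T = S"
  unfolding adj_def
proof (rule the_equality)
  fix R assume R: "\<forall>x y. cinner (T x) y = cinner x (R y)"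
  have "coord (R y) k = coord (S y) k" for y k
    using R assms cinner_basis_vec complex_cnj_cancel_iff by metis
  then show "R = S" by (intro ext ell2_eqI)
qed (use assms in blast)

section \<open>The unital Boolean algebra\<close>

text \<open>The index set \<open>{#} \<union> \<int>\<close> is \<open>int option\<close>, with \<open>None\<close> in the role of \<open>#\<close>.\<close>

type_synonym boolean_fock = "int option ell2"

definition boolean_algebra :: "(boolean_fock \<Rightarrow> boolean_fock) set"
  where "boolean_algebra = {\<lambda>x. A x + a *\<^sub>C x |A a. compact_op A}"

text \<open>A functional on the algebra is a function that is \<open>undefined\<close> outside it, so that equality
  of functionals is equality on the algebra.  The algebra being unital, a positive functional has
  norm one exactly if it maps the identity to \<open>1\<close>.\<close>

definition is_state :: "((boolean_fock \<Rightarrow> boolean_fock) \<Rightarrow> complex) \<Rightarrow> bool"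
  where "is_state \<omega> \<longleftrightarrow>
    \<omega> \<in> extensional boolean_algebra \<and>
    (\<forall>S\<in>boolean_algebra. \<forall>T\<in>boolean_algebra. \<omega> (\<lambda>x. S x + T x) = \<omega> S + \<omega> T) \<and>
    (\<forall>c. \<forall>T\<in>boolean_algebra. \<omega> (\<lambda>x. c *\<^sub>C T x) = c * \<omega> T) \<and>
    (\<forall>T\<in>boolean_algebra. \<omega> (adj T \<circ> T) \<in> \<real>\<^sub>\<ge>\<^sub>0) \<and>
    \<omega> id = 1"

lemma bij_map_option:
  assumes "bij h"
  shows "bij (map_option h)"
  by (rule o_bij[of "map_option (inv h)"])
    (use assms in \<open>auto simp: fun_eq_iff option.map_comp o_def bij_is_inj surj_f_inv_f bij_is_surj
      option.map_ident\<close>)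

text \<open>\<open>int perm\<close> is the group of permutations of \<open>\<int>\<close> moving only finitely many elements.\<close>

lift_definition perm_unitary :: "int perm \<Rightarrow> boolean_fock \<Rightarrow> boolean_fock"
  is "\<lambda>g f k. f (map_option (inv g) k)"
proof -
  fix g :: "int \<Rightarrow> int" and f :: "int option \<Rightarrow> complex"
  assume g: "bij g \<and> finite {a. g a \<noteq> a}" and f: "(\<lambda>i. (cmod (f i))\<^sup>2) summable_on UNIV"
  have "bij (map_option (inv g))"
    using g by (intro bij_map_option bij_imp_bij_inv) blast
  then show "(\<lambda>k. (cmod (f (map_option (inv g) k)))\<^sup>2) summable_on UNIV"
    using f by (simp add: summable_on_reindex_bij_betw[where f = "\<lambda>i. (cmod (f i))\<^sup>2"])
qed

lemma perm_unitary_vacuum: "perm_unitary g (basis_vec None) = basis_vec None"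
  by (rule ell2_eqI) (simp add: perm_unitary.rep_eq basis_vec.rep_eq)

lemma perm_unitary_basis: "perm_unitary g (basis_vec (Some i)) = basis_vec (Some (apply g i))"
proof (rule ell2_eqI)
  fix k
  show "coord (perm_unitary g (basis_vec (Some i))) k = coord (basis_vec (Some (apply g i))) k"
    by (cases k) (auto simp: perm_unitary.rep_eq basis_vec.rep_eq bij_is_inj bij_is_surj surj_f_inv_f)
qed

lemma perm_unitary_adj: "adj (perm_unitary g) = perm_unitary (inverse g)"
proof (rule adj_eqI)
  fix x y
  let ?h = "map_option (inv (apply g))"
  have h: "bij ?h" by (intro bij_map_option bij_imp_bij_inv bij_apply)
  have eq: "map_option (apply g) (?h k) = k" for k
    by (cases k) (simp_all add: surj_f_inv_f bij_is_surj)
  have "cinner (perm_unitary g x) y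
      = (\<Sum>\<^sub>\<infinity>k. coord x (?h k) * cnj (coord y (map_option (apply g) (?h k))))"
    by (simp add: cinner_def perm_unitary.rep_eq eq)
  also have "\<dots> = (\<Sum>\<^sub>\<infinity>k. coord x k * cnj (coord y (map_option (apply g) k)))"
    using h by (rule infsum_reindex_bij_betw)
  also have "\<dots> = cinner x (perm_unitary (inverse g) y)"
    by (simp add: cinner_def perm_unitary.rep_eq inverse_perm.rep_eq inv_inv_eq)
  finally show "cinner (perm_unitary g x) y = cinner x (perm_unitary (inverse g) y)" .
qed

lemma perm_unitary_inverse: "perm_unitary (inverse g) (perm_unitary g x) = x"
  "perm_unitary g (perm_unitary (inverse g) x) = x"
  by (rule ell2_eqI, simp add: perm_unitary.rep_eq inverse_perm.rep_eq inv_inv_eq option.map_comp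
      o_def bij_is_inj surj_f_inv_f bij_is_surj option.map_ident)+

definition perm_action ::
    "int perm \<Rightarrow> (boolean_fock \<Rightarrow> boolean_fock) \<Rightarrow> boolean_fock \<Rightarrow> boolean_fock"
  where "perm_action g T = perm_unitary g \<circ> T \<circ> adj (perm_unitary g)"

definition symmetric_states :: "((boolean_fock \<Rightarrow> boolean_fock) \<Rightarrow> complex) set"
  where "symmetric_states =
    {\<omega>. is_state \<omega> \<and> (\<forall>g. \<forall>T\<in>boolean_algebra. \<omega> (perm_action g T) = \<omega> T)}"

definition vacuum_state :: "(boolean_fock \<Rightarrow> boolean_fock) \<Rightarrow> complex"
  where "vacuum_state = (\<lambda>T\<in>boolean_algebra. cinner (T (basis_vec None)) (basis_vec None))"

text \<open>The scalar \<open>a\<close> is unique because the identity is not compact.\<close>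

definition state_at_infinity :: "(boolean_fock \<Rightarrow> boolean_fock) \<Rightarrow> complex"
  where "state_at_infinity =
    (\<lambda>T\<in>boolean_algebra. THE a. \<exists>A. compact_op A \<and> T = (\<lambda>x. A x + a *\<^sub>C x))"

definition mix ::
    "real \<Rightarrow> ((boolean_fock \<Rightarrow> boolean_fock) \<Rightarrow> complex) \<Rightarrow>
      ((boolean_fock \<Rightarrow> boolean_fock) \<Rightarrow> complex) \<Rightarrow> (boolean_fock \<Rightarrow> boolean_fock) \<Rightarrow> complex"
  where "mix \<gamma> \<phi> \<psi> =
    (\<lambda>T\<in>boolean_algebra. complex_of_real \<gamma> * \<phi> T + complex_of_real (1 - \<gamma>) * \<psi> T)"

text \<open>Pointwise convergence on the algebra; on the dual space this is the weak-* topology.\<close>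

definition weak_star_topology :: "((boolean_fock \<Rightarrow> boolean_fock) \<Rightarrow> complex) topology"
  where "weak_star_topology = product_topology (\<lambda>_. euclidean) boolean_algebra"

end

theory Submission
  imports Defs
begin

text \<open>A symmetric state \<open>\<omega>\<close> takes the same value \<open>p\<close> on all projections onto the lines spanned by
  \<open>e\<^sub>i\<close>, \<open>i \<in> \<int>\<close>.  Arbitrarily many of them add up to at most the identity, so \<open>p = 0\<close>: outside the
  vacuum \<open>\<omega>\<close> sees no finite set of coordinates.  It remains to conclude that \<open>\<omega>\<close> annihilates every
  compact operator \<open>R A\<close> and \<open>A R\<close>, where \<open>R\<close> is the projection onto the complement of the vacuum.
  Then \<open>\<omega>\<close> is determined on compact operators by the vacuum matrix entry, namely
  \<open>\<omega> A = \<langle>A e\<^sub>#, e\<^sub>#\<rangle> \<gamma>\<close> with \<open>\<gamma>\<close> the value on the vacuum projection (\<open>symmetric_state_compact\<close>),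
  and \<open>\<omega> (A + a I) = \<gamma> \<langle>A e\<^sub>#, e\<^sub>#\<rangle> + a\<close> is the asserted mixture.

  The usual way to that conclusion approximates \<open>A\<close> by finite matrices and uses that positive
  functionals are norm-continuous, which rests on square roots of positive operators.  Here only
  square roots of diagonal operators occur.  A compact operator factors as \<open>A = D B\<close> with \<open>D\<close>
  diagonal, nonnegative, with entries tending to zero, and \<open>B\<close> again compact
  (\<open>compact_op_factorization\<close>).  Positivity on diagonal operators and \<open>p = 0\<close> give
  \<open>\<omega> ((R D)\<^sup>2) = 0\<close>, since up to finitely many coordinates \<open>(R D)\<^sup>2\<close> lies below any positive
  multiple of the identity (\<open>symmetric_state_null_diag\<close>).  By the Cauchy-Schwarz inequality
  \<open>\<omega> (R D B) = 0\<close> (\<open>state_null\<close>); the operators \<open>A R\<close> are treated by taking adjoints.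

  Compactness is used throughout in the form of uniformly small tails
  (\<open>compact_op_iff_uniform_tails\<close>).  It gives the factorization, the closure of the Boolean algebra
  under products and adjoints, and the uniqueness of the scalar part, and hence that both extreme
  points are symmetric states.  The set of symmetric states is then the image of \<open>[0, 1]\<close> under a
  map that is continuous for pointwise convergence, so it is compact.\<close>

section \<open>Geometry of square-summable families\<close>

lemma cinner_add_left: "cinner (x + y) z = cinner x z + cinner y z"
  by (simp add: cinner_def distrib_right infsum_add cinner_summable)

lemma cinner_scaleC_left: "cinner (c *\<^sub>C x) z = c * cinner x z"
  by (simp add: cinner_def mult.assoc infsum_cmult_right')

lemma cinner_commute: "cinner y x = cnj (cinner x y)"
  unfolding cinner_def by (subst infsum_cnj[symmetric]) (simp add: mult.commute)

lemma cinner_add_right: "cinner x (y + z) = cinner x y + cinner x z"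
  using cinner_add_left[of y z x] cinner_commute[of x y] cinner_commute[of x z]
    cinner_commute[of x "y + z"] by simp

lemma cinner_scaleC_right: "cinner x (c *\<^sub>C y) = cnj c * cinner x y"
  using cinner_scaleC_left[of c y x] cinner_commute[of x y] cinner_commute[of x "c *\<^sub>C y"] by simp

lemma cinner_zero_left [simp]: "cinner 0 x = 0"
  by (simp add: cinner_def)

lemma cinner_basis_right: "cinner x (basis_vec k) = coord x k"
  using cinner_basis_vec[of k x] cinner_commute[of x "basis_vec k"] by simp

lemma norm_sq_infsum: "(norm x)\<^sup>2 = (\<Sum>\<^sub>\<infinity>i. (cmod (coord x i))\<^sup>2)"
  by (simp add: norm_ell2_def infsum_nonneg)

lemma cinner_self: "cinner x x = complex_of_real ((norm x)\<^sup>2)"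
proof (rule complex_eqI)
  show "Re (cinner x x) = Re (complex_of_real ((norm x)\<^sup>2))"
    by (simp add: power2_norm_eq_inner inner_ell2_def)
  have "cinner x x = cnj (cinner x x)"
    by (rule cinner_commute)
  then show "Im (cinner x x) = Im (complex_of_real ((norm x)\<^sup>2))"
    by (metis Im_complex_of_real complex_is_Real_iff Reals_cnj_iff)
qed

lemma norm_scaleC: "norm (c *\<^sub>C x :: 'i ell2) = cmod c * norm x"
proof -
  have "(norm (c *\<^sub>C x))\<^sup>2 = (cmod c * norm x)\<^sup>2"
    by (simp add: norm_sq_infsum power_mult_distrib norm_mult infsum_cmult_right')
  then show ?thesis
    by (simp add: power2_eq_iff_nonneg)
qed

lemma cmod_cinner_le: "cmod (cinner x y) \<le> norm x * norm y"
proof -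
  \<comment> \<open>Rotating \<open>x\<close> by the phase of \<open>cinner x y\<close> reduces the claim to the real inner product.\<close>
  define c where "c = cnj (sgn (cinner x y))"
  have "c * cinner x y = complex_of_real (cmod (cinner x y))"
    by (cases "cinner x y = 0")
      (simp_all add: c_def sgn_eq mult.commute[of "cnj _"] power2_eq_square flip: complex_norm_square)
  then have "cmod (cinner x y) = inner (c *\<^sub>C x) y"
    by (simp add: inner_ell2_def cinner_scaleC_left)
  also have "\<dots> \<le> norm (c *\<^sub>C x) * norm y"
    by (rule norm_cauchy_schwarz)
  also have "\<dots> \<le> norm x * norm y"
    by (intro mult_right_mono) (simp_all add: norm_scaleC c_def norm_sgn)
  finally show ?thesis .
qed

lemma sum_le_norm_sq: "finite F \<Longrightarrow> (\<Sum>i\<in>F. (cmod (coord x i))\<^sup>2) \<le> (norm x)\<^sup>2"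
  unfolding norm_sq_infsum by (intro finite_sum_le_infsum square_summable_coord) auto

lemma cmod_coord_le: "cmod (coord x i) \<le> norm x"
  using sum_le_norm_sq[of "{i}" x] by (intro power2_le_imp_le[OF _ norm_ge_zero]) simp

lemma norm_le_of_sums:
  assumes "\<And>F. finite F \<Longrightarrow> (\<Sum>i\<in>F. (cmod (coord x i))\<^sup>2) \<le> K\<^sup>2" "0 \<le> K"
  shows "norm x \<le> K"
proof -
  have "(norm x)\<^sup>2 \<le> K\<^sup>2"
    unfolding norm_sq_infsum using assms(1)
    by (intro infsum_le_finite_sums square_summable_coord) auto
  then show ?thesis
    using assms(2) by (rule power2_le_imp_le)
qed

lemma ell2_of_bounded_sums:
  assumes "\<And>F. finite F \<Longrightarrow> (\<Sum>i\<in>F. (cmod (f i))\<^sup>2) \<le> K\<^sup>2" "0 \<le> K"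
  obtains x where "coord x = f" "norm x \<le> K"
proof -
  have "(\<lambda>i. (cmod (f i))\<^sup>2) summable_on UNIV"
    using assms(1) by (intro nonneg_bdd_above_summable_on) (auto intro!: bdd_aboveI[of _ "K\<^sup>2"])
  then have "coord (Abs_ell2 f) = f"
    by (simp add: Abs_ell2_inverse)
  moreover from this have "norm (Abs_ell2 f) \<le> K"
    using assms by (intro norm_le_of_sums) auto
  ultimately show thesis
    using that by blast
qed

lemma coord_diff [simp]: "coord (x - y) i = coord x i - coord y i"
  using coord_simps_aux(2)[of x "- y" i] by simp

lemma coord_sum: "coord (sum f F) i = (\<Sum>k\<in>F. coord (f k) i)"
  by (induction F rule: infinite_finite_induct) auto

text \<open>Coordinates of a Cauchy sequence converge, and a uniform bound on the finite partial sums of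
  a distance survives the passage to the limit.\<close>

instance ell2 :: (type) complete_space
proof
  fix X :: "nat \<Rightarrow> 'a ell2"
  assume X: "Cauchy X"
  have "Cauchy (\<lambda>n. coord (X n) i)" for i
  proof (rule metric_CauchyI)
    fix e :: real assume "0 < e"
    with X obtain N where "\<forall>m\<ge>N. \<forall>n\<ge>N. dist (X m) (X n) < e"
      by (blast dest: metric_CauchyD)
    moreover have "dist (coord (X m) i) (coord (X n) i) \<le> dist (X m) (X n)" for m n
      using cmod_coord_le[of "X m - X n" i] by (simp add: dist_norm)
    ultimately show "\<exists>N. \<forall>m\<ge>N. \<forall>n\<ge>N. dist (coord (X m) i) (coord (X n) i) < e"
      using order.strict_trans1 by blast
  qed
  then have "\<exists>l. (\<lambda>n. coord (X n) i) \<longlonglongrightarrow> l" for i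
    using Cauchy_convergent convergent_def by blast
  then obtain f where f: "\<And>i. (\<lambda>n. coord (X n) i) \<longlonglongrightarrow> f i"
    by metis
  have close: "\<exists>y. coord y = (\<lambda>i. f i - coord (X m) i) \<and> norm y \<le> e"
    if "0 \<le> e" "\<And>n. n \<ge> m \<Longrightarrow> dist (X n) (X m) \<le> e" for m e
  proof -
    have "(\<Sum>i\<in>F. (cmod (f i - coord (X m) i))\<^sup>2) \<le> e\<^sup>2" if "finite F" for F
    proof (rule tendsto_upperbound)
      show "(\<lambda>n. \<Sum>i\<in>F. (cmod (coord (X n) i - coord (X m) i))\<^sup>2)
          \<longlonglongrightarrow> (\<Sum>i\<in>F. (cmod (f i - coord (X m) i))\<^sup>2)"
        by (intro tendsto_intros f)
      have "(\<Sum>i\<in>F. (cmod (coord (X n) i - coord (X m) i))\<^sup>2) \<le> e\<^sup>2" if "n \<ge> m" for n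
      proof -
        have "(\<Sum>i\<in>F. (cmod (coord (X n) i - coord (X m) i))\<^sup>2) \<le> (norm (X n - X m))\<^sup>2"
          using sum_le_norm_sq[OF \<open>finite F\<close>, of "X n - X m"] by simp
        also have "\<dots> \<le> e\<^sup>2"
          using \<open>\<And>n. n \<ge> m \<Longrightarrow> dist (X n) (X m) \<le> e\<close>[OF that] by (simp add: dist_norm power_mono)
        finally show ?thesis .
      qed
      then show "\<forall>\<^sub>F n in sequentially. (\<Sum>i\<in>F. (cmod (coord (X n) i - coord (X m) i))\<^sup>2) \<le> e\<^sup>2"
        by (auto simp: eventually_sequentially)
    qed simp
    with \<open>0 \<le> e\<close> show ?thesis
      by (metis ell2_of_bounded_sums)
  qed
  have cau: "\<exists>M. \<forall>m\<ge>M. \<forall>n\<ge>M. dist (X n) (X m) \<le> e" if "e > 0" for e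
    using metric_CauchyD[OF X that] by (meson less_imp_le)
  obtain M where "\<And>n. n \<ge> M \<Longrightarrow> dist (X n) (X M) \<le> 1"
    using cau[of 1] by auto
  then obtain y where y: "coord y = (\<lambda>i. f i - coord (X M) i)"
    using close[of 1 M] by auto
  define x where "x = y + X M"
  have x: "coord x = f"
    by (auto simp: x_def y)
  have "X \<longlonglongrightarrow> x"
  proof (rule metric_LIMSEQ_I)
    fix e :: real assume "0 < e"
    then obtain N where N: "\<And>m n. m \<ge> N \<Longrightarrow> n \<ge> N \<Longrightarrow> dist (X n) (X m) \<le> e / 2"
      using cau[of "e / 2"] by auto
    have "dist (X m) x < e" if m: "m \<ge> N" for m
    proof -
      have "\<exists>z. coord z = (\<lambda>i. f i - coord (X m) i) \<and> norm z \<le> e / 2"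
        using m \<open>0 < e\<close> by (intro close N) auto
      then obtain z where z: "coord z = (\<lambda>i. f i - coord (X m) i)" "norm z \<le> e / 2"
        by blast
      have "z = x - X m"
        by (rule ell2_eqI) (simp add: z x)
      with z \<open>0 < e\<close> show ?thesis
        by (simp add: dist_norm norm_minus_commute)
    qed
    then show "\<exists>N. \<forall>m\<ge>N. dist (X m) x < e"
      by blast
  qed
  then show "convergent X"
    by (auto simp: convergent_def)
qed

section \<open>Bounded operators and their adjoints\<close>

lemma scaleC_add_right: "c *\<^sub>C (x + y) = c *\<^sub>C x + c *\<^sub>C (y :: 'i ell2)"
  by (rule ell2_eqI) (simp add: distrib_left)

lemma scaleC_scaleC: "c *\<^sub>C d *\<^sub>C x = (c * d) *\<^sub>C (x :: 'i ell2)"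
  by (rule ell2_eqI) (simp add: mult.assoc)

lemma scaleC_commute: "c *\<^sub>C d *\<^sub>C x = d *\<^sub>C c *\<^sub>C (x :: 'i ell2)"
  by (simp add: scaleC_scaleC mult.commute)

lemma scaleC_one [simp]: "1 *\<^sub>C x = (x :: 'i ell2)"
  by (rule ell2_eqI) simp

lemma scaleC_zero [simp]: "0 *\<^sub>C x = (0 :: 'i ell2)"
  by (rule ell2_eqI) simp

lemma bounded_clinear_opI:
  assumes "\<And>x y. T (x + y) = T x + T y" "\<And>c x. T (c *\<^sub>C x) = c *\<^sub>C T x"
    "\<And>x. norm (T x) \<le> K * norm x"
  shows "bounded_clinear_op T"
  unfolding bounded_clinear_op_def
proof (intro conjI bounded_linear_intro[where K = K])
  show "norm (T x) \<le> norm x * K" for x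
    using assms(3)[of x] by (simp add: mult.commute)
qed (simp_all add: assms scaleR_ell2_def)

context
  fixes T :: "'i ell2 \<Rightarrow> 'i ell2"
  assumes T: "bounded_clinear_op T"
begin

lemma bop_linear: "bounded_linear T"
  using T by (simp add: bounded_clinear_op_def)

lemma bop_add: "T (x + y) = T x + T y"
  using bop_linear by (simp add: linear_simps)

lemma bop_scaleR: "T (r *\<^sub>R x) = r *\<^sub>R T x"
  using bop_linear by (simp add: linear_simps)

lemma bop_zero: "T 0 = 0"
  using bop_linear by (simp add: linear_simps)

lemma bop_sum: "T (sum f F) = (\<Sum>i\<in>F. T (f i))"
  by (rule linear_sum[OF bounded_linear.linear[OF bop_linear]])

lemma bop_scaleC: "T (c *\<^sub>C x) = c *\<^sub>C T x"
  using T by (simp add: bounded_clinear_op_def)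

lemma bop_bound: obtains K where "0 < K" "\<And>x. norm (T x) \<le> K * norm x"
  using bounded_linear.pos_bounded[OF bop_linear] by (auto simp: mult.commute)

end

lemma bounded_clinear_op_id: "bounded_clinear_op id"
  by (rule bounded_clinear_opI[where K = 1]) auto

lemma bounded_clinear_op_add:
  assumes "bounded_clinear_op S" "bounded_clinear_op T"
  shows "bounded_clinear_op (\<lambda>x. S x + T x)"
  using assms by (auto simp: bounded_clinear_op_def scaleC_add_right intro: bounded_linear_add)

lemma bounded_clinear_op_scale:
  assumes "bounded_clinear_op T"
  shows "bounded_clinear_op (\<lambda>x. c *\<^sub>C T x)"
proof -
  obtain K where K: "\<And>x. norm (T x) \<le> K * norm x"
    using bop_bound[OF assms] by blast
  show ?thesis
  proof (rule bounded_clinear_opI)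
    show "norm (c *\<^sub>C T x) \<le> (cmod c * K) * norm x" for x
      using mult_left_mono[OF K[of x], of "cmod c"] by (simp add: norm_scaleC mult.assoc)
  qed (simp_all add: bop_add[OF assms] bop_scaleC[OF assms] scaleC_add_right scaleC_commute)
qed

lemma bounded_clinear_op_comp:
  assumes "bounded_clinear_op S" "bounded_clinear_op T"
  shows "bounded_clinear_op (S \<circ> T)"
  using assms
  by (auto simp: bounded_clinear_op_def o_def intro: bounded_linear_compose)

text \<open>Real entries make diagonal operators self-adjoint.  The definition is meaningful for bounded
  \<open>m\<close> only; for other \<open>m\<close> the family on the right need not be square-summable.\<close>

definition diag :: "('i \<Rightarrow> real) \<Rightarrow> 'i ell2 \<Rightarrow> 'i ell2"
  where "diag m x = Abs_ell2 (\<lambda>i. complex_of_real (m i) * coord x i)"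

abbreviation proj :: "'i set \<Rightarrow> 'i ell2 \<Rightarrow> 'i ell2"
  where "proj S \<equiv> diag (indicator S)"

lemma
  assumes "\<And>i. \<bar>m i\<bar> \<le> K"
  shows coord_diag: "coord (diag m x) i = complex_of_real (m i) * coord x i"
    and norm_diag_le: "norm (diag m x) \<le> K * norm x"
proof -
  have K: "0 \<le> K"
    using assms[of undefined] by linarith
  have "(\<Sum>i\<in>F. (cmod (complex_of_real (m i) * coord x i))\<^sup>2) \<le> (K * norm x)\<^sup>2" if "finite F" for F
  proof -
    have "(\<Sum>i\<in>F. (cmod (complex_of_real (m i) * coord x i))\<^sup>2) \<le> (\<Sum>i\<in>F. K\<^sup>2 * (cmod (coord x i))\<^sup>2)"
      using K assms by (intro sum_mono) (auto simp: norm_mult power_mult_distrib abs_le_square_iff[symmetric]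
          intro!: mult_right_mono)
    also have "\<dots> \<le> K\<^sup>2 * (norm x)\<^sup>2"
      by (simp add: sum_distrib_left[symmetric] mult_left_mono sum_le_norm_sq that)
    finally show ?thesis
      by (simp add: power_mult_distrib)
  qed
  then obtain y where y: "coord y = (\<lambda>i. complex_of_real (m i) * coord x i)" "norm y \<le> K * norm x"
    using K by (elim ell2_of_bounded_sums) auto
  then have "diag m x = y"
    unfolding diag_def by (metis coord_inverse)
  with y show "coord (diag m x) i = complex_of_real (m i) * coord x i" "norm (diag m x) \<le> K * norm x"
    by simp_all
qed

lemma coord_proj [simp]: "coord (proj S x) i = (if i \<in> S then coord x i else 0)"
  by (subst coord_diag[where K = 1]) (auto simp: indicator_def)

lemma norm_proj_le: "norm (proj S x) \<le> norm x"
  using norm_diag_le[of "indicator S" 1 x] by (auto simp: indicator_def)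

lemma bounded_clinear_op_diag:
  assumes "\<And>i. \<bar>m i\<bar> \<le> K"
  shows "bounded_clinear_op (diag m)"
  by (rule bounded_clinear_opI[OF _ _ norm_diag_le[OF assms]])
    (auto intro!: ell2_eqI simp: coord_diag[OF assms] algebra_simps)

lemma bounded_clinear_op_proj: "bounded_clinear_op (proj S)"
  by (rule bounded_clinear_op_diag[where K = 1]) (auto simp: indicator_def)

lemma diag_comp:
  assumes "\<And>i. \<bar>m i\<bar> \<le> K" "\<And>i. \<bar>n i\<bar> \<le> L"
  shows "diag m (diag n x) = diag (\<lambda>i. m i * n i) x"
proof (rule ell2_eqI)
  have "\<bar>m i * n i\<bar> \<le> K * L" for i
    unfolding abs_mult using assms[of i] by (intro mult_mono) auto
  then show "coord (diag m (diag n x)) i = coord (diag (\<lambda>i. m i * n i) x) i" for i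
    by (simp add: coord_diag[OF assms(1)] coord_diag[OF assms(2)] coord_diag[where K = "K * L"])
qed

lemma cinner_diag:
  assumes "\<And>i. \<bar>m i\<bar> \<le> K"
  shows "cinner (diag m x) y = cinner x (diag m y)"
  unfolding cinner_def by (simp add: coord_diag[OF assms] mult_ac)

lemma proj_finite: "finite F \<Longrightarrow> proj F x = (\<Sum>i\<in>F. coord x i *\<^sub>C basis_vec i)"
  by (rule ell2_eqI) (simp add: coord_sum basis_vec.rep_eq if_distrib cong: if_cong)

lemma proj_plus_complement: "proj F x + proj (- F) x = x"
  by (rule ell2_eqI) simp

lemma norm_proj_mono:
  assumes "S \<subseteq> S'"
  shows "norm (proj S x) \<le> norm (proj S' x)"
proof -
  have "proj S x = proj S (proj S' x)"
    using assms by (intro ell2_eqI) auto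
  then show ?thesis
    by (metis norm_proj_le)
qed

lemma norm_basis_vec [simp]: "norm (basis_vec i) = 1"
proof -
  have "(norm (basis_vec i))\<^sup>2 = 1"
    using cinner_self[of "basis_vec i"] cinner_basis_right[of "basis_vec i" i]
    by (simp add: basis_vec.rep_eq del: of_real_power)
  then show ?thesis
    using norm_ge_zero[of "basis_vec i"] unfolding power2_eq_1_iff by linarith
qed

lemma norm_le_sum_plus_tail:
  assumes "finite F"
  shows "norm x \<le> (\<Sum>i\<in>F. cmod (coord x i)) + norm (proj (- F) x)"
proof -
  have "norm x \<le> norm (proj F x) + norm (proj (- F) x)"
    using norm_triangle_ineq[of "proj F x" "proj (- F) x"] by (simp add: proj_plus_complement)
  moreover have "norm (proj F x) \<le> (\<Sum>i\<in>F. cmod (coord x i))"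
    unfolding proj_finite[OF assms] by (rule sum_norm_le) (simp add: norm_scaleC)
  ultimately show ?thesis
    by simp
qed

lemma norm_proj_complement_small:
  fixes x :: "'i ell2"
  assumes "0 < e"
  obtains F where "finite F" "norm (proj (- F) x) < e"
proof -
  obtain F where F: "finite F"
    "dist (\<Sum>i\<in>F. (cmod (coord x i))\<^sup>2) (\<Sum>\<^sub>\<infinity>i. (cmod (coord x i))\<^sup>2) \<le> (e / 2)\<^sup>2"
    using infsum_finite_approximation[OF square_summable_coord, of "(e / 2)\<^sup>2" x] assms by auto
  have "(\<Sum>i\<in>G. (cmod (coord (proj (- F) x) i))\<^sup>2) \<le> (e / 2)\<^sup>2" if "finite G" for G
  proof -
    have "(\<Sum>i\<in>F. (cmod (coord x i))\<^sup>2) + (\<Sum>i\<in>G. (cmod (coord (proj (- F) x) i))\<^sup>2)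
        = (\<Sum>i\<in>F. (cmod (coord x i))\<^sup>2) + (\<Sum>i\<in>G - F. (cmod (coord x i))\<^sup>2)"
      using that by (intro arg_cong2[where f = "(+)"] refl sum.mono_neutral_cong_right) auto
    also have "\<dots> = (\<Sum>i\<in>F \<union> (G - F). (cmod (coord x i))\<^sup>2)"
      using F that by (intro sum.union_disjoint[symmetric]) auto
    also have "\<dots> \<le> (\<Sum>\<^sub>\<infinity>i. (cmod (coord x i))\<^sup>2)"
      using sum_le_norm_sq[of "F \<union> (G - F)" x] F that by (simp add: norm_sq_infsum)
    finally show ?thesis
      using F(2) by (simp add: dist_real_def abs_le_iff)
  qed
  then have "norm (proj (- F) x) \<le> e / 2"
    using assms by (intro norm_le_of_sums) auto
  with that[OF F(1)] assms show thesis
    by linarith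
qed

text \<open>The adjoint has to send \<open>y\<close> to the family \<open>\<lambda>i. cinner y (T (basis_vec i))\<close>.  Pairing \<open>y\<close>
  with \<open>T z\<close>, where \<open>z\<close> is a finite part of that family, bounds its partial sums.\<close>

lemma adjoint_exists:
  assumes "bounded_clinear_op T"
  obtains S where "bounded_clinear_op S" "\<And>x y. cinner (T x) y = cinner x (S y)"
proof -
  obtain K where K: "0 < K" "\<And>x. norm (T x) \<le> K * norm x"
    using bop_bound[OF assms] by blast
  have "(\<Sum>i\<in>F. (cmod (cinner y (T (basis_vec i))))\<^sup>2) \<le> (K * norm y)\<^sup>2" if F: "finite F" for y F
  proof -
    define c where "c i = cinner y (T (basis_vec i))" for i
    define z where "z = (\<Sum>i\<in>F. c i *\<^sub>C basis_vec i)"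
    define s where "s = (\<Sum>i\<in>F. (cmod (c i))\<^sup>2)"
    have zc: "coord z i = (if i \<in> F then c i else 0)" for i
      using F by (simp add: z_def coord_sum basis_vec.rep_eq if_distrib cong: if_cong)
    have "norm z \<le> sqrt s"
    proof (rule norm_le_of_sums)
      fix G :: "'a set" assume "finite G"
      then have "(\<Sum>i\<in>G. (cmod (coord z i))\<^sup>2) = (\<Sum>i\<in>G \<inter> F. (cmod (c i))\<^sup>2)"
        using F by (intro sum.mono_neutral_cong_right) (auto simp: zc)
      also have "\<dots> \<le> s"
        unfolding s_def using F by (intro sum_mono2) auto
      finally show "(\<Sum>i\<in>G. (cmod (coord z i))\<^sup>2) \<le> (sqrt s)\<^sup>2"
        by (simp add: s_def sum_nonneg)
    qed (simp add: s_def sum_nonneg)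
    have "cinner (T z) y = complex_of_real s"
    proof -
      have "cinner (\<Sum>i\<in>F. c i *\<^sub>C T (basis_vec i)) y = (\<Sum>i\<in>F. c i * cnj (c i))"
        using F by induction (simp_all add: cinner_add_left cinner_scaleC_left c_def
            cinner_commute[of "T (basis_vec _)"])
      then show ?thesis
        by (simp add: z_def bop_sum[OF assms] bop_scaleC[OF assms] s_def complex_norm_square[symmetric])
    qed
    moreover have "0 \<le> s"
      by (simp add: s_def sum_nonneg)
    ultimately have "s \<le> norm (T z) * norm y"
      using cmod_cinner_le[of "T z" y] by simp
    also have "\<dots> \<le> K * norm z * norm y"
      by (intro mult_right_mono K) simp
    also have "\<dots> \<le> K * sqrt s * norm y"
      using \<open>norm z \<le> sqrt s\<close> K by (intro mult_right_mono mult_left_mono) auto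
    finally have le: "sqrt s * sqrt s \<le> (K * norm y) * sqrt s"
      using \<open>0 \<le> s\<close> by (simp add: mult_ac)
    have "sqrt s \<le> K * norm y"
    proof (cases "s = 0")
      case False
      with \<open>0 \<le> s\<close> have "0 < sqrt s"
        by simp
      with le show ?thesis
        by (rule mult_right_le_imp_le)
    qed (use K(1) in simp)
    then have "(sqrt s)\<^sup>2 \<le> (K * norm y)\<^sup>2"
      by (intro power_mono) (auto simp: s_def sum_nonneg)
    then show ?thesis
      by (simp add: s_def sum_nonneg c_def)
  qed
  then have "\<exists>x. coord x = (\<lambda>i. cinner y (T (basis_vec i))) \<and> norm x \<le> K * norm y" for y
    using K(1) by (metis ell2_of_bounded_sums less_imp_le mult_nonneg_nonneg norm_ge_zero)
  then obtain S where S: "\<And>y. coord (S y) = (\<lambda>i. cinner y (T (basis_vec i)))"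
    "\<And>y. norm (S y) \<le> K * norm y"
    by metis
  show thesis
  proof
    show "bounded_clinear_op S"
      by (rule bounded_clinear_opI[OF _ _ S(2)])
        (auto intro!: ell2_eqI simp: S(1) cinner_add_left cinner_scaleC_left)
    fix x y
    \<comment> \<open>Both sides agree for finitely supported \<open>x\<close>, and these are dense.\<close>
    have fin: "cinner (T (proj F x)) y = cinner (proj F x) (S y)" if "finite F" for F
    proof -
      have "cinner (\<Sum>i\<in>F. coord x i *\<^sub>C T (basis_vec i)) y
          = cinner (\<Sum>i\<in>F. coord x i *\<^sub>C basis_vec i) (S y)"
        using that by induction (simp_all add: cinner_add_left cinner_scaleC_left S(1)
            cinner_basis_vec cinner_commute[of "T (basis_vec _)"])
      then show ?thesis
        by (simp add: proj_finite[OF that] bop_sum[OF assms] bop_scaleC[OF assms])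
    qed
    have "cmod (cinner (T x) y - cinner x (S y)) \<le> e" if "0 < e" for e
    proof -
      define d where "d = e / (2 * K * norm y + 1)"
      have den: "0 < 2 * K * norm y + 1"
        using K(1) by (simp add: add_nonneg_pos)
      then have "0 < d"
        using that by (simp add: d_def)
      then obtain F where F: "finite F" "norm (proj (- F) x) < d"
        using norm_proj_complement_small by blast
      let ?r = "proj (- F) x"
      have "cinner (T x) y - cinner x (S y) = cinner (T ?r) y - cinner ?r (S y)"
        using fin[OF F(1)] proj_plus_complement[of F x]
        by (metis (no_types, lifting) add_diff_cancel_left bop_add[OF assms] cinner_add_left)
      also have "cmod \<dots> \<le> norm (T ?r) * norm y + norm ?r * norm (S y)"
        by (rule order_trans[OF norm_triangle_ineq4]) (intro add_mono cmod_cinner_le)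
      also have "\<dots> \<le> (K * norm ?r) * norm y + norm ?r * (K * norm y)"
        by (intro add_mono mult_right_mono mult_left_mono K S) auto
      also have "\<dots> = norm ?r * (2 * K * norm y)"
        by (simp add: algebra_simps)
      also have "\<dots> \<le> d * (2 * K * norm y + 1)"
        using F(2) K(1) \<open>0 < d\<close> by (intro mult_mono) auto
      also have "\<dots> = e"
        using den by (simp add: d_def)
      finally show ?thesis .
    qed
    then have "cmod (cinner (T x) y - cinner x (S y)) \<le> 0"
      by (rule field_le_epsilon) simp
    then show "cinner (T x) y = cinner x (S y)"
      by simp
  qed
qed

lemma
  assumes "bounded_clinear_op T"
  shows bounded_clinear_op_adj: "bounded_clinear_op (adj T)"
    and cinner_adj: "cinner (T x) y = cinner x (adj T y)"
proof -
  obtain S where S: "bounded_clinear_op S" "\<And>x y. cinner (T x) y = cinner x (S y)"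
    using adjoint_exists[OF assms] by blast
  then have "adj T = S"
    by (intro adj_eqI) auto
  with S show "bounded_clinear_op (adj T)" "cinner (T x) y = cinner x (adj T y)"
    by simp_all
qed

lemma cinner_adj': "bounded_clinear_op T \<Longrightarrow> cinner x (T y) = cinner (adj T x) y"
  using cinner_adj[of T y x] cinner_commute[of x "T y"] cinner_commute[of "adj T x" y] by simp

lemma adj_adj: "bounded_clinear_op T \<Longrightarrow> adj (adj T) = T"
  by (rule adj_eqI) (rule cinner_adj'[symmetric])

lemma adj_comp:
  assumes "bounded_clinear_op S" "bounded_clinear_op T"
  shows "adj (S \<circ> T) = adj T \<circ> adj S"
  by (rule adj_eqI) (simp add: cinner_adj[OF assms(1)] cinner_adj[OF assms(2)])

lemma adj_add:
  assumes "bounded_clinear_op S" "bounded_clinear_op T"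
  shows "adj (\<lambda>x. S x + T x) = (\<lambda>x. adj S x + adj T x)"
  by (rule adj_eqI)
    (simp add: cinner_add_left cinner_add_right cinner_adj[OF assms(1)] cinner_adj[OF assms(2)])

lemma adj_scale:
  assumes "bounded_clinear_op T"
  shows "adj (\<lambda>x. c *\<^sub>C T x) = (\<lambda>x. cnj c *\<^sub>C adj T x)"
  by (rule adj_eqI) (simp add: cinner_scaleC_left cinner_scaleC_right cinner_adj[OF assms])

lemma adj_diag: "(\<And>i. \<bar>m i\<bar> \<le> K) \<Longrightarrow> adj (diag m) = diag m"
  by (rule adj_eqI) (rule cinner_diag)

section \<open>Compact operators\<close>

lemma compact_op_imp_bounded: "compact_op A \<Longrightarrow> bounded_clinear_op A"
  by (simp add: compact_op_def)

lemma bop_norm_le_of_unit_ball: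
  assumes T: "bounded_clinear_op T" and le: "\<And>x. norm x \<le> 1 \<Longrightarrow> norm (T x) \<le> e"
  shows "norm (T x) \<le> e * norm x"
proof (cases "x = 0")
  case False
  then have "norm (T (inverse (norm x) *\<^sub>R x)) \<le> e"
    by (intro le) simp
  with False show ?thesis
    by (simp add: bop_scaleR[OF T] divide_simps)
qed (simp add: bop_zero[OF T])

lemma compact_finite_box:
  assumes "finite F"
  shows "compact ((\<lambda>c. \<Sum>i\<in>F. c i *\<^sub>C basis_vec i) ` {c. \<forall>i. cmod (c i) \<le> K})"
  using assms
proof induction
  case empty
  show ?case
    by (auto intro: compact_Int simp: image_constant_conv)
next
  case (insert j F)
  let ?B = "\<lambda>F. (\<lambda>c. \<Sum>i\<in>F. c i *\<^sub>C basis_vec i) ` {c. \<forall>i. cmod (c i) \<le> K}"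
  have "bounded_linear (\<lambda>z. z *\<^sub>C basis_vec j)"
    by (rule bounded_linear_intro[where K = 1])
      (auto intro!: ell2_eqI simp: distrib_right norm_scaleC scaleR_conv_of_real)
  then have "continuous_on (cball 0 K \<times> ?B F) (\<lambda>p. fst p *\<^sub>C basis_vec j + snd p)"
    by (intro continuous_intros linear_continuous_on_compose[where g = "\<lambda>z. z *\<^sub>C basis_vec j"]
        bounded_linear.linear continuous_on_fst continuous_on_id
        bounded_linear.continuous_on[where g = fst])
  then have "compact ((\<lambda>p. fst p *\<^sub>C basis_vec j + snd p) ` (cball 0 K \<times> ?B F))"
    by (intro compact_continuous_image compact_Times insert.IH compact_cball)
  moreover have "(\<lambda>p. fst p *\<^sub>C basis_vec j + snd p) ` (cball 0 K \<times> ?B F) = ?B (insert j F)"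
  proof (intro equalityI subsetI)
    fix y assume "y \<in> (\<lambda>p. fst p *\<^sub>C basis_vec j + snd p) ` (cball 0 K \<times> ?B F)"
    then obtain z c where zc: "cmod z \<le> K" "\<forall>i. cmod (c i) \<le> K"
      "y = z *\<^sub>C basis_vec j + (\<Sum>i\<in>F. c i *\<^sub>C basis_vec i)"
      by auto
    have "(\<Sum>i\<in>F. c i *\<^sub>C basis_vec i) = (\<Sum>i\<in>F. (c(j := z)) i *\<^sub>C basis_vec i)"
      using insert.hyps by (intro sum.cong) auto
    then have "y = (\<Sum>i\<in>insert j F. (c(j := z)) i *\<^sub>C basis_vec i)"
      using insert.hyps zc(3) by simp
    then show "y \<in> ?B (insert j F)"
      using zc by (intro image_eqI[where x = "c(j := z)"]) auto
  next
    fix y assume "y \<in> ?B (insert j F)"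
    then obtain c where c: "\<forall>i. cmod (c i) \<le> K" "y = (\<Sum>i\<in>insert j F. c i *\<^sub>C basis_vec i)"
      by auto
    then show "y \<in> (\<lambda>p. fst p *\<^sub>C basis_vec j + snd p) ` (cball 0 K \<times> ?B F)"
      using insert.hyps
      by (intro image_eqI[where x = "(c j, \<Sum>i\<in>F. c i *\<^sub>C basis_vec i)"]) auto
  qed
  ultimately show ?case
    by simp
qed

lemma compact_finite_net:
  assumes "compact S" "0 < e"
  obtains k where "finite k" "S \<subseteq> (\<Union>c\<in>k. ball c e)"
  using assms unfolding compact_eq_totally_bounded by blast

text \<open>Compactness means that the image of the unit ball is approximated by finitely many
  coordinates, uniformly.  For the forward direction finitely many vectors form a net of the image
  and each has small tails; conversely the coordinates in \<open>F\<close> vary in a compact box.  This criterion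
  replaces the topological definition everywhere below.\<close>

lemma compact_op_iff_uniform_tails:
  "compact_op A \<longleftrightarrow> bounded_clinear_op A \<and>
    (\<forall>e>0. \<exists>F. finite F \<and> (\<forall>x. norm (proj (- F) (A x)) \<le> e * norm x))"
proof (intro iffI conjI allI impI)
  assume A: "compact_op A"
  then show bA: "bounded_clinear_op A"
    by (rule compact_op_imp_bounded)
  fix e :: real assume "0 < e"
  then obtain k where k: "finite k" "closure (A ` cball 0 1) \<subseteq> (\<Union>c\<in>k. ball c (e / 2))"
    using compact_finite_net[of "closure (A ` cball 0 1)" "e / 2"] A by (auto simp: compact_op_def)
  have "\<exists>F. finite F \<and> norm (proj (- F) c) < e / 2" for c :: "'a ell2"
    by (rule norm_proj_complement_small[of "e / 2" c]) (use \<open>0 < e\<close> in auto)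
  then obtain G where G: "\<And>c. finite (G c)" "\<And>c :: 'a ell2. norm (proj (- G c) c) < e / 2"
    by metis
  define F where "F = (\<Union>c\<in>k. G c)"
  have "norm ((proj (- F) \<circ> A) x) \<le> e * norm x" for x
  proof (rule bop_norm_le_of_unit_ball)
    fix x :: "'a ell2" assume "norm x \<le> 1"
    then have "A x \<in> A ` cball 0 1"
      by simp
    then have "A x \<in> (\<Union>c\<in>k. ball c (e / 2))"
      by (rule subsetD[OF k(2) subsetD[OF closure_subset]])
    then obtain c where c: "c \<in> k" "norm (A x - c) < e / 2"
      by (auto simp: dist_norm norm_minus_commute)
    have "proj (- F) (A x) = proj (- F) (A x - c) + proj (- F) c"
      by (rule ell2_eqI) simp
    then have "norm (proj (- F) (A x)) \<le> norm (proj (- F) (A x - c)) + norm (proj (- F) c)"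
      by (simp only: norm_triangle_ineq)
    also have "\<dots> \<le> norm (A x - c) + norm (proj (- G c) c)"
      using c by (intro add_mono norm_proj_le norm_proj_mono) (auto simp: F_def)
    finally show "norm ((proj (- F) \<circ> A) x) \<le> e"
      using c(2) G(2)[of c] by simp
  qed (intro bounded_clinear_op_comp bounded_clinear_op_proj bA)
  moreover have "finite F"
    using k G by (simp add: F_def)
  ultimately show "\<exists>F. finite F \<and> (\<forall>x. norm (proj (- F) (A x)) \<le> e * norm x)"
    by auto
next
  assume *: "bounded_clinear_op A \<and>
    (\<forall>e>0. \<exists>F. finite F \<and> (\<forall>x. norm (proj (- F) (A x)) \<le> e * norm x))"
  then obtain K where K: "0 < K" "\<And>x. norm (A x) \<le> K * norm x"
    using bop_bound[of A] by blast
  have "\<exists>k. finite k \<and> closure (A ` cball 0 1) \<subseteq> (\<Union>c\<in>k. ball c e)" if e: "0 < e" for e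
  proof -
    have e4: "0 < e / 4"
      using e by simp
    with * obtain F where F: "finite F" "\<And>x. norm (proj (- F) (A x)) \<le> (e / 4) * norm x"
      by blast
    obtain k where k: "finite k"
      "(\<lambda>c. \<Sum>i\<in>F. c i *\<^sub>C basis_vec i) ` {c. \<forall>i. cmod (c i) \<le> K} \<subseteq> (\<Union>c\<in>k. ball c (e / 4))"
      using compact_finite_net[OF compact_finite_box[OF F(1), of K] e4] by blast
    have "A ` cball 0 1 \<subseteq> (\<Union>c\<in>k. cball c (e / 2))"
    proof (rule image_subsetI)
      fix x :: "'a ell2" assume "x \<in> cball 0 1"
      then have x: "norm x \<le> 1"
        by simp
      have "norm (A x) \<le> K"
        using order_trans[OF K(2)[of x] mult_left_mono[OF x, of K]] K(1) by simp
      then have "\<forall>i. cmod (coord (A x) i) \<le> K"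
        by (intro allI order_trans[OF cmod_coord_le])
      then have "proj F (A x) \<in> (\<Union>c\<in>k. ball c (e / 4))"
        unfolding proj_finite[OF F(1)] by (intro subsetD[OF k(2)] image_eqI[where x = "coord (A x)"]) auto
      then obtain c where c: "c \<in> k" "dist c (proj F (A x)) < e / 4"
        by auto
      have "dist (proj F (A x)) (A x) = norm (proj (- F) (A x))"
      proof -
        have "A x - proj F (A x) = proj (- F) (A x)"
          by (rule ell2_eqI) simp
        then show ?thesis
          by (simp add: dist_norm norm_minus_commute)
      qed
      also have "\<dots> \<le> e / 4"
        using order_trans[OF F(2)[of x] mult_left_mono[OF x, of "e / 4"]] e by simp
      finally have "dist c (A x) \<le> e / 2"
        using dist_triangle[of c "A x" "proj F (A x)"] c(2) by simp
      with c(1) show "A x \<in> (\<Union>c\<in>k. cball c (e / 2))"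
        by auto
    qed
    then have "closure (A ` cball 0 1) \<subseteq> (\<Union>c\<in>k. cball c (e / 2))"
      using k(1) by (intro closure_minimal closed_UN) auto
    also have "\<dots> \<subseteq> (\<Union>c\<in>k. ball c e)"
      using e by (intro UN_mono) auto
    finally show ?thesis
      using k(1) by blast
  qed
  then have "compact (closure (A ` cball 0 1))"
    by (simp add: compact_eq_totally_bounded complete_eq_closed)
  with * show "compact_op A"
    by (simp add: compact_op_def)
qed

lemma compact_op_tail:
  assumes "compact_op A" "0 < e"
  obtains F where "finite F" "\<And>x. norm (proj (- F) (A x)) \<le> e * norm x"
  using assms unfolding compact_op_iff_uniform_tails by blast

lemma compact_op_zero: "compact_op (\<lambda>x. 0)"
proof -
  have "proj S 0 = 0" for S :: "'a set"
    by (rule bop_zero[OF bounded_clinear_op_proj])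
  then show ?thesis
    unfolding compact_op_iff_uniform_tails
    by (auto intro!: bounded_clinear_opI[where K = 0] exI[of _ "{}"] ell2_eqI)
qed

lemma compact_op_add:
  assumes A: "compact_op A" and B: "compact_op B"
  shows "compact_op (\<lambda>x. A x + B x)"
  unfolding compact_op_iff_uniform_tails
proof (intro conjI allI impI)
  show "bounded_clinear_op (\<lambda>x. A x + B x)"
    using assms by (intro bounded_clinear_op_add compact_op_imp_bounded)
  fix e :: real assume "0 < e"
  then have e: "0 < e / 2"
    by simp
  obtain F where F: "finite F" "\<And>x. norm (proj (- F) (A x)) \<le> e / 2 * norm x"
    using compact_op_tail[OF A e] by blast
  obtain G where G: "finite G" "\<And>x. norm (proj (- G) (B x)) \<le> e / 2 * norm x"
    using compact_op_tail[OF B e] by blast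
  have "norm (proj (- (F \<union> G)) (A x + B x)) \<le> e * norm x" for x
  proof -
    have "norm (proj (- (F \<union> G)) (A x + B x))
        \<le> norm (proj (- (F \<union> G)) (A x)) + norm (proj (- (F \<union> G)) (B x))"
      by (simp only: bop_add[OF bounded_clinear_op_proj] norm_triangle_ineq)
    also have "\<dots> \<le> norm (proj (- F) (A x)) + norm (proj (- G) (B x))"
      by (intro add_mono norm_proj_mono) auto
    finally show ?thesis
      using F(2)[of x] G(2)[of x] by simp
  qed
  with F(1) G(1) show "\<exists>F. finite F \<and> (\<forall>x. norm (proj (- F) (A x + B x)) \<le> e * norm x)"
    by (intro exI[of _ "F \<union> G"]) simp
qed

lemma compact_op_comp_right:
  assumes A: "compact_op A" and T: "bounded_clinear_op T"
  shows "compact_op (A \<circ> T)"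
  unfolding compact_op_iff_uniform_tails
proof (intro conjI allI impI)
  show "bounded_clinear_op (A \<circ> T)"
    by (intro bounded_clinear_op_comp compact_op_imp_bounded A T)
  obtain K where K: "0 < K" "\<And>x. norm (T x) \<le> K * norm x"
    using bop_bound[OF T] by blast
  fix e :: real assume "0 < e"
  then have e: "0 < e / K"
    using K(1) by simp
  obtain F where F: "finite F" "\<And>x. norm (proj (- F) (A x)) \<le> e / K * norm x"
    using compact_op_tail[OF A e] by blast
  have "norm (proj (- F) ((A \<circ> T) x)) \<le> e * norm x" for x
  proof -
    have "norm (proj (- F) ((A \<circ> T) x)) \<le> e / K * (K * norm x)"
      using F(2)[of "T x"] mult_left_mono[OF K(2)[of x], of "e / K"] e by simp
    then show ?thesis
      using K(1) by simp
  qed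
  with F(1) show "\<exists>F. finite F \<and> (\<forall>x. norm (proj (- F) ((A \<circ> T) x)) \<le> e * norm x)"
    by blast
qed

lemma compact_op_scale:
  assumes "compact_op A"
  shows "compact_op (\<lambda>x. c *\<^sub>C A x)"
proof -
  have "(\<lambda>x. c *\<^sub>C A x) = A \<circ> (\<lambda>x. c *\<^sub>C id x)"
    by (auto simp: bop_scaleC[OF compact_op_imp_bounded[OF assms]])
  then show ?thesis
    by (simp only: compact_op_comp_right[OF assms bounded_clinear_op_scale[OF bounded_clinear_op_id]])
qed

text \<open>Schauder's theorem.  Small tails of \<open>A\<close>, together with small tails of the finitely many
  vectors \<open>adj A (basis_vec i)\<close>, make \<open>A\<close> small on vectors supported outside a finite set; this
  passes to the tails of the adjoint by duality.\<close>

lemma compact_op_adj: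
  assumes A: "compact_op A"
  shows "compact_op (adj A)"
  unfolding compact_op_iff_uniform_tails
proof (intro conjI allI impI)
  have bA: "bounded_clinear_op A"
    using A by (rule compact_op_imp_bounded)
  then show "bounded_clinear_op (adj A)"
    by (rule bounded_clinear_op_adj)
  fix e :: real assume e: "0 < e"
  then have e2: "0 < e / 2"
    by simp
  obtain F where F: "finite F" "\<And>x. norm (proj (- F) (A x)) \<le> e / 2 * norm x"
    using compact_op_tail[OF A e2] by blast
  define d where "d = e / (2 * (real (card F) + 1))"
  have d: "0 < d"
    using e by (simp add: d_def)
  have "\<exists>G. finite G \<and> norm (proj (- G) (adj A (basis_vec i))) < d" for i
    by (rule norm_proj_complement_small[OF d, of "adj A (basis_vec i)"]) auto
  then obtain G where G: "\<And>i. finite (G i)" "\<And>i. norm (proj (- G i) (adj A (basis_vec i))) < d"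
    by metis
  define H where "H = (\<Union>i\<in>F. G i)"
  have small: "norm (A (proj (- H) x)) \<le> e * norm x" for x
  proof -
    have "cmod (coord (A (proj (- H) x)) i) \<le> d * norm x" if "i \<in> F" for i
    proof -
      have "coord (A (proj (- H) x)) i = cinner x (proj (- H) (adj A (basis_vec i)))"
        by (subst cinner_basis_right[symmetric], subst cinner_adj[OF bA], rule cinner_diag[where K = 1])
          (simp add: indicator_def)
      also have "cmod \<dots> \<le> norm x * norm (proj (- H) (adj A (basis_vec i)))"
        by (rule cmod_cinner_le)
      also have "\<dots> \<le> norm x * norm (proj (- G i) (adj A (basis_vec i)))"
        using that by (intro mult_left_mono norm_proj_mono) (auto simp: H_def)
      also have "\<dots> \<le> norm x * d"
        using G(2)[of i] by (intro mult_left_mono) auto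
      finally show ?thesis
        by (simp add: mult.commute)
    qed
    then have "(\<Sum>i\<in>F. cmod (coord (A (proj (- H) x)) i)) \<le> real (card F) * (d * norm x)"
      by (rule sum_bounded_above)
    also have "\<dots> \<le> e / 2 * norm x"
    proof -
      have "real (card F) * d \<le> e / 2"
        using e by (simp add: d_def divide_simps)
      then show ?thesis
        by (simp add: mult.assoc[symmetric] mult_right_mono del: times_divide_eq_left)
    qed
    moreover have "norm (proj (- F) (A (proj (- H) x))) \<le> e / 2 * norm x"
    proof -
      have "norm (proj (- F) (A (proj (- H) x))) \<le> e / 2 * norm (proj (- H) x)"
        by (rule F(2))
      also have "\<dots> \<le> e / 2 * norm x"
        using e by (intro mult_left_mono norm_proj_le) auto
      finally show ?thesis .
    qed
    ultimately show ?thesis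
      using norm_le_sum_plus_tail[OF F(1), of "A (proj (- H) x)"] by simp
  qed
  have "norm (proj (- H) (adj A y)) \<le> e * norm y" for y
  proof -
    define v where "v = proj (- H) (adj A y)"
    have "complex_of_real ((norm v)\<^sup>2) = cinner (proj (- H) (adj A y)) v"
      by (simp only: cinner_self v_def)
    also have "\<dots> = cinner (adj A y) (proj (- H) v)"
      by (rule cinner_diag[where K = 1]) (simp add: indicator_def)
    also have "\<dots> = cinner y (A (proj (- H) v))"
      by (rule cinner_adj'[OF bA, symmetric])
    finally have "cmod (complex_of_real ((norm v)\<^sup>2)) = cmod (cinner y (A (proj (- H) v)))"
      by (rule arg_cong)
    then have "(norm v)\<^sup>2 \<le> norm y * norm (A (proj (- H) v))"
      using cmod_cinner_le[of y "A (proj (- H) v)"] by (simp only: norm_of_real abs_power2)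
    also have "\<dots> \<le> norm y * (e * norm v)"
      by (intro mult_left_mono small) simp
    finally have "norm v * norm v \<le> (e * norm y) * norm v"
      by (simp add: power2_eq_square mult_ac)
    then show ?thesis
      using e by (cases "v = 0") (auto simp: v_def[symmetric])
  qed
  moreover have "finite H"
    using F(1) G(1) by (simp add: H_def)
  ultimately show "\<exists>F. finite F \<and> (\<forall>x. norm (proj (- F) (adj A x)) \<le> e * norm x)"
    by blast
qed

lemma compact_op_comp_left:
  assumes A: "compact_op A" and T: "bounded_clinear_op T"
  shows "compact_op (T \<circ> A)"
proof -
  have bA: "bounded_clinear_op A"
    using A by (rule compact_op_imp_bounded)
  have "T \<circ> A = adj (adj A \<circ> adj T)"
    by (simp add: adj_comp adj_adj bounded_clinear_op_adj bA T)
  moreover have "compact_op (adj (adj A \<circ> adj T))"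
    by (intro compact_op_adj compact_op_comp_right A bounded_clinear_op_adj T)
  ultimately show ?thesis
    by simp
qed

text \<open>In infinite dimension a nonzero multiple of the identity has unit vectors arbitrarily far out
  whose images have large tails.\<close>

lemma compact_scalar_op_zero:
  assumes "infinite (UNIV :: 'i set)" "compact_op (\<lambda>x :: 'i ell2. a *\<^sub>C x)"
  shows "a = 0"
proof (rule ccontr)
  assume "a \<noteq> 0"
  then have "0 < cmod a / 2"
    by simp
  then obtain F where F: "finite F" "\<And>x :: 'i ell2. norm (proj (- F) (a *\<^sub>C x)) \<le> cmod a / 2 * norm x"
    using compact_op_tail[OF assms(2)] by blast
  obtain i where "i \<notin> F"
    using F(1) assms(1) ex_new_if_finite by blast
  then have "proj (- F) (a *\<^sub>C basis_vec i) = a *\<^sub>C basis_vec i"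
    by (intro ell2_eqI) (auto simp: basis_vec.rep_eq)
  with F(2)[of "basis_vec i"] \<open>a \<noteq> 0\<close> show False
    by (simp add: norm_scaleC)
qed

section \<open>Diagonal operators and factorization\<close>

lemma cofinite_limit_bounded:
  fixes m :: "'i \<Rightarrow> real"
  assumes "(m \<longlongrightarrow> c) cofinite"
  obtains K where "\<And>i. \<bar>m i\<bar> \<le> K"
proof
  have "eventually (\<lambda>i. dist (m i) c < 1) cofinite"
    using assms by (rule tendstoD) simp
  then have E: "finite {i. \<not> dist (m i) c < 1}" (is "finite ?E")
    by (simp add: eventually_cofinite)
  fix i
  show "\<bar>m i\<bar> \<le> \<bar>c\<bar> + 1 + (\<Sum>i\<in>?E. \<bar>m i\<bar>)"
  proof (cases "i \<in> ?E")
    case True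
    then have "\<bar>m i\<bar> \<le> (\<Sum>i\<in>?E. \<bar>m i\<bar>)"
      using E by (intro member_le_sum) auto
    then show ?thesis
      by linarith
  next
    case False
    then have "\<bar>m i\<bar> \<le> \<bar>c\<bar> + 1"
      by (simp add: dist_real_def)
    moreover have "0 \<le> (\<Sum>i\<in>?E. \<bar>m i\<bar>)"
      by (rule sum_nonneg) simp
    ultimately show ?thesis
      by linarith
  qed
qed

lemma compact_op_diag:
  assumes m: "(m \<longlongrightarrow> 0) cofinite"
  shows "compact_op (diag m)"
  unfolding compact_op_iff_uniform_tails
proof (intro conjI allI impI)
  obtain K where K: "\<And>i. \<bar>m i\<bar> \<le> K"
    using cofinite_limit_bounded[OF m] by blast
  then show "bounded_clinear_op (diag m)"
    by (rule bounded_clinear_op_diag)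
  fix e :: real assume e: "0 < e"
  define F where "F = {i. \<not> \<bar>m i\<bar> < e}"
  have "finite F"
    using tendstoD[OF m e] by (simp add: F_def eventually_cofinite)
  moreover have "norm (proj (- F) (diag m x)) \<le> e * norm x" for x
  proof -
    have "proj (- F) (diag m x) = diag (\<lambda>i. indicator (- F) i * m i) x"
      by (rule diag_comp[where K = 1, OF _ K]) (simp add: indicator_def)
    also have "norm \<dots> \<le> e * norm x"
      using e by (intro norm_diag_le) (auto simp: F_def indicator_def)
    finally show ?thesis .
  qed
  ultimately show "\<exists>F. finite F \<and> (\<forall>x. norm (proj (- F) (diag m x)) \<le> e * norm x)"
    by blast
qed

text \<open>The uniformly small tails of a compact operator leave room to divide the coordinates of its
  values by a null sequence.  Let the tails outside \<open>F n\<close> have norm at most \<open>(1/2) ^ n\<close> and let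
  coordinate \<open>i\<close> have the weight \<open>2 ^ n\<close> with \<open>n\<close> least such that \<open>i \<in> F n\<close>.  As
  \<open>2 ^ n = 1 + (\<Sum>k<n. 2 ^ k)\<close>, the weighted square norm of a value of \<open>A\<close> on the unit ball is at
  most its square norm plus the sum over \<open>k\<close> of \<open>2 ^ k\<close> times its square norm outside \<open>F k\<close>.  The
  latter terms are at most \<open>2 ^ k * (1/4) ^ k\<close>, so that the series converges, and \<open>d\<close> is the
  inverse square root of the weight.\<close>

lemma compact_op_weight:
  assumes A: "compact_op A"
  obtains d B where "\<And>i. 0 \<le> d i" "(d \<longlongrightarrow> 0) cofinite" "bounded_clinear_op B" "\<And>x. A x = diag d (B x)"
proof -
  have bA: "bounded_clinear_op A"
    using A by (rule compact_op_imp_bounded)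
  obtain K where K: "0 < K" "\<And>x. norm (A x) \<le> K * norm x"
    using bop_bound[OF bA] by blast
  have "\<exists>F. finite F \<and> (\<forall>x. norm (proj (- F) (A x)) \<le> (1 / 2) ^ n * norm x)" for n :: nat
    by (rule compact_op_tail[OF A, of "(1 / 2) ^ n"]) auto
  then obtain F where F: "\<And>n. finite (F n)"
    "\<And>n x. norm (proj (- F n) (A x)) \<le> (1 / 2) ^ n * norm x"
    by metis
  define lev where "lev i = (LEAST n. i \<in> F n)" for i
  have lev: "i \<in> F (lev i)" if "i \<in> F n" for i n
    using that unfolding lev_def by (rule LeastI)
  have below: "i \<notin> F n" if "n < lev i" for i n
    using that not_less_Least unfolding lev_def by blast
  define d where "d i = (if i \<in> F (lev i) then sqrt ((1 / 2) ^ lev i) else 0)" for i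
  have d0: "0 \<le> d i" and d1: "\<bar>d i\<bar> \<le> 1" for i
    by (auto simp: d_def power_le_one)
  have lim: "(d \<longlongrightarrow> 0) cofinite"
  proof (rule tendstoI)
    fix e :: real assume e: "0 < e"
    then obtain N where N: "(1 / 2) ^ N < e\<^sup>2"
      using real_arch_pow_inv[of "e\<^sup>2" "1 / 2"] by auto
    have "i \<in> (\<Union>n<N. F n)" if "\<not> dist (d i) 0 < e" for i
    proof -
      have "e \<le> d i"
        using that d0[of i] by (simp add: dist_real_def)
      then have i: "i \<in> F (lev i)" "e \<le> sqrt ((1 / 2) ^ lev i)"
        using e by (auto simp: d_def split: if_splits)
      have "e\<^sup>2 \<le> (1 / 2) ^ lev i"
        using power_mono[OF i(2), of 2] e by simp
      then have "(1 / 2 :: real) ^ N < (1 / 2) ^ lev i"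
        using N by linarith
      then have "lev i < N"
        by simp
      with i(1) show ?thesis
        by blast
    qed
    then have "{i. \<not> dist (d i) 0 < e} \<subseteq> (\<Union>n<N. F n)"
      by blast
    then show "\<forall>\<^sub>F i in cofinite. dist (d i) 0 < e"
      unfolding eventually_cofinite using F(1) by (rule_tac finite_subset) auto
  qed
  define b where "b x i = coord (A x) i / complex_of_real (d i)" for x i
  \<comment> \<open>The estimate yields the factor \<open>K\<^sup>2 + (\<Sum>n. 2 ^ n * (1/4) ^ n) = K\<^sup>2 + 2\<close>; the square
    \<open>(K + 2)\<^sup>2\<close> is a convenient upper bound.\<close>
  have "(\<Sum>i\<in>G. (cmod (b x i))\<^sup>2) \<le> ((K + 2) * norm x)\<^sup>2" if G: "finite G" for G x
  proof -
    define a where "a i = (cmod (coord (A x) i))\<^sup>2" for i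
    obtain N where N: "\<And>i. i \<in> G \<Longrightarrow> lev i \<le> N"
      using finite_nat_set_iff_bounded_le[of "lev ` G"] G by auto
    have "(cmod (b x i))\<^sup>2 \<le> a i + (\<Sum>n<N. 2 ^ n * (indicator (- F n) i * a i))" if "i \<in> G" for i
    proof -
      have "(cmod (b x i))\<^sup>2 \<le> 2 ^ lev i * a i"
        by (auto simp: b_def d_def a_def norm_divide power_divide field_simps)
      also have "(2 :: real) ^ lev i = 1 + (\<Sum>n<lev i. 2 ^ n)"
        by (induction "lev i") (simp_all add: sum_gp_strict)
      also have "(1 + (\<Sum>n<lev i. 2 ^ n)) * a i
          = a i + (\<Sum>n<lev i. 2 ^ n * (indicator (- F n) i * a i))"
        by (simp add: distrib_right sum_distrib_right below)
      also have "\<dots> \<le> a i + (\<Sum>n<N. 2 ^ n * (indicator (- F n) i * a i))"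
        using N[OF that] by (intro add_left_mono sum_mono2) (auto simp: a_def)
      finally show ?thesis .
    qed
    then have "(\<Sum>i\<in>G. (cmod (b x i))\<^sup>2)
        \<le> (\<Sum>i\<in>G. a i + (\<Sum>n<N. 2 ^ n * (indicator (- F n) i * a i)))"
      by (rule sum_mono)
    also have "\<dots> = (\<Sum>i\<in>G. a i) + (\<Sum>n<N. 2 ^ n * (\<Sum>i\<in>G. indicator (- F n) i * a i))"
      by (simp add: sum.distrib sum_distrib_left sum.swap[of _ G])
    also have "\<dots> \<le> (K * norm x)\<^sup>2 + (\<Sum>n<N. 2 ^ n * ((1 / 2) ^ n * norm x)\<^sup>2)"
    proof (intro add_mono sum_mono mult_left_mono)
      have "(\<Sum>i\<in>G. a i) \<le> (norm (A x))\<^sup>2"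
        unfolding a_def by (rule sum_le_norm_sq[OF G])
      also have "\<dots> \<le> (K * norm x)\<^sup>2"
        by (intro power_mono K) simp
      finally show "(\<Sum>i\<in>G. a i) \<le> (K * norm x)\<^sup>2" .
      fix n
      have "(\<Sum>i\<in>G. indicator (- F n) i * a i) = (\<Sum>i\<in>G. (cmod (coord (proj (- F n) (A x)) i))\<^sup>2)"
        by (intro sum.cong) (auto simp: a_def)
      also have "\<dots> \<le> (norm (proj (- F n) (A x)))\<^sup>2"
        by (rule sum_le_norm_sq[OF G])
      also have "\<dots> \<le> ((1 / 2) ^ n * norm x)\<^sup>2"
        by (intro power_mono F) simp
      finally show "(\<Sum>i\<in>G. indicator (- F n) i * a i) \<le> ((1 / 2) ^ n * norm x)\<^sup>2" .
    qed simp
    also have "(\<Sum>n<N. 2 ^ n * ((1 / 2) ^ n * norm x)\<^sup>2) = (\<Sum>n<N. (1 / 2) ^ n) * (norm x)\<^sup>2"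
    proof -
      have "(2 :: real) ^ n * ((1 / 2) ^ n * norm x)\<^sup>2 = (1 / 2) ^ n * (norm x)\<^sup>2" for n
        by (simp add: power_mult_distrib power2_eq_square power_one_over field_simps)
      then show ?thesis
        by (simp add: sum_distrib_right)
    qed
    also have "(K * norm x)\<^sup>2 + (\<Sum>n<N. (1 / 2) ^ n) * (norm x)\<^sup>2 \<le> (K * norm x)\<^sup>2 + 2 * (norm x)\<^sup>2"
    proof -
      have "(\<Sum>n<N. (1 / 2 :: real) ^ n) = 2 - 2 * (1 / 2) ^ N"
        by (induction N) simp_all
      then show ?thesis
        by (intro add_left_mono mult_right_mono) auto
    qed
    also have "(K * norm x)\<^sup>2 + 2 * (norm x)\<^sup>2 \<le> ((K + 2) * norm x)\<^sup>2"
    proof -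
      have "K\<^sup>2 + 2 \<le> (K + 2)\<^sup>2"
        using K(1) by (simp add: power2_eq_square algebra_simps)
      then have "(K\<^sup>2 + 2) * (norm x)\<^sup>2 \<le> (K + 2)\<^sup>2 * (norm x)\<^sup>2"
        by (rule mult_right_mono) simp
      then show ?thesis
        by (simp only: power_mult_distrib distrib_right[of "K\<^sup>2"])
    qed
    finally show ?thesis
      by simp
  qed
  then have "\<exists>y. coord y = b x \<and> norm y \<le> (K + 2) * norm x" for x
    by (rule ell2_of_bounded_sums[of "b x" "(K + 2) * norm x"]) (use K(1) in auto)
  then obtain B where B: "\<And>x. coord (B x) = b x" "\<And>x. norm (B x) \<le> (K + 2) * norm x"
    by metis
  show thesis
  proof
    show "bounded_clinear_op B"
      by (rule bounded_clinear_opI[OF _ _ B(2)])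
        (auto intro!: ell2_eqI simp: B(1) b_def bop_add[OF bA] bop_scaleC[OF bA] add_divide_distrib)
    fix x
    \<comment> \<open>Where \<open>d\<close> vanishes, no \<open>F n\<close> contains the coordinate, so that all values of \<open>A\<close> vanish there.\<close>
    have zero: "coord (A x) i = 0" if "d i = 0" for i
    proof -
      have "i \<notin> F n" for n
        using that lev[of i n] by (auto simp: d_def)
      then have "cmod (coord (A x) i) \<le> (1 / 2) ^ n * norm x" for n
        using cmod_coord_le[of "proj (- F n) (A x)" i] F(2)[of n x] by simp
      moreover have "(\<lambda>n. (1 / 2) ^ n * norm x) \<longlonglongrightarrow> 0 * norm x"
        by (intro tendsto_mult_right LIMSEQ_power_zero) simp
      ultimately have "cmod (coord (A x) i) \<le> 0 * norm x"
        by (intro LIMSEQ_le_const[of _ "0 * norm x" "cmod (coord (A x) i)"]) auto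
      then show ?thesis
        by simp
    qed
    show "A x = diag d (B x)"
      using zero by (intro ell2_eqI) (auto simp: coord_diag[OF d1] B(1) b_def)
  qed (fact d0 lim)+
qed

text \<open>Taking square roots of the weights distributes them over both factors, so that the second
  factor is compact, too.\<close>

lemma compact_op_factorization:
  assumes A: "compact_op A"
  obtains d B where "\<And>i. 0 \<le> d i" "(d \<longlongrightarrow> 0) cofinite" "compact_op B" "A = diag d \<circ> B"
proof -
  obtain d B where d: "\<And>i. 0 \<le> d i" "(d \<longlongrightarrow> 0) cofinite" and B: "bounded_clinear_op B"
    and AB: "\<And>x. A x = diag d (B x)"
    using compact_op_weight[OF A] by blast
  define s where "s i = sqrt (d i)" for i
  have lim: "(s \<longlongrightarrow> 0) cofinite"
    using tendsto_real_sqrt[OF d(2)] by (simp add: s_def[abs_def])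
  then obtain K where K: "\<And>i. \<bar>s i\<bar> \<le> K"
    using cofinite_limit_bounded by blast
  show thesis
  proof
    show "compact_op (diag s \<circ> B)"
      by (intro compact_op_comp_right compact_op_diag lim B)
    show "A = diag s \<circ> (diag s \<circ> B)"
      using d(1) by (auto simp: AB diag_comp[OF K K] s_def)
  qed (use d(1) lim in \<open>auto simp: s_def\<close>)
qed

section \<open>The Boolean algebra modulo the compact operators\<close>

text \<open>\<open>scalar_mod_compact T a\<close>: the image of \<open>T\<close> in the Calkin algebra is the scalar \<open>a\<close>.  Keeping
  the scalar as an argument yields closure properties of the Boolean algebra and multiplicativity of
  the state at infinity at once.\<close>

definition scalar_mod_compact :: "('i ell2 \<Rightarrow> 'i ell2) \<Rightarrow> complex \<Rightarrow> bool"
  where "scalar_mod_compact T a \<longleftrightarrow> (\<exists>A. compact_op A \<and> T = (\<lambda>x. A x + a *\<^sub>C x))"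

lemma scalar_mod_compactI: "compact_op A \<Longrightarrow> (\<And>x. T x = A x + a *\<^sub>C x) \<Longrightarrow> scalar_mod_compact T a"
  unfolding scalar_mod_compact_def by blast

lemma scalar_mod_compactE:
  assumes "scalar_mod_compact T a"
  obtains A where "compact_op A" "\<And>x. T x = A x + a *\<^sub>C x"
  using assms unfolding scalar_mod_compact_def by auto

lemma boolean_algebra_iff: "T \<in> boolean_algebra \<longleftrightarrow> (\<exists>a. scalar_mod_compact T a)"
  by (auto simp: boolean_algebra_def scalar_mod_compact_def)

lemma scalar_mod_compact_compact: "compact_op A \<Longrightarrow> scalar_mod_compact A 0"
  by (rule scalar_mod_compactI) auto

lemma scalar_mod_compact_id: "scalar_mod_compact id 1"
  by (rule scalar_mod_compactI[OF compact_op_zero]) auto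

lemma scalar_mod_compact_bounded:
  assumes "scalar_mod_compact T a"
  shows "bounded_clinear_op T"
proof -
  obtain A where A: "compact_op A" "\<And>x. T x = A x + a *\<^sub>C x"
    using scalar_mod_compactE[OF assms] by blast
  have "T = (\<lambda>x. A x + a *\<^sub>C id x)"
    by (simp add: A(2) fun_eq_iff)
  then show ?thesis
    by (simp only: bounded_clinear_op_add bounded_clinear_op_scale bounded_clinear_op_id
        compact_op_imp_bounded[OF A(1)])
qed

lemma scalar_mod_compact_add:
  assumes S: "scalar_mod_compact S a" and T: "scalar_mod_compact T b"
  shows "scalar_mod_compact (\<lambda>x. S x + T x) (a + b)"
proof -
  obtain A where A: "compact_op A" "\<And>x. S x = A x + a *\<^sub>C x"
    using scalar_mod_compactE[OF S] by blast
  obtain B where B: "compact_op B" "\<And>x. T x = B x + b *\<^sub>C x"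
    using scalar_mod_compactE[OF T] by blast
  show ?thesis
    by (rule scalar_mod_compactI[OF compact_op_add[OF A(1) B(1)]])
      (rule ell2_eqI, simp add: A(2) B(2) algebra_simps)
qed

lemma scalar_mod_compact_scale:
  assumes T: "scalar_mod_compact T a"
  shows "scalar_mod_compact (\<lambda>x. c *\<^sub>C T x) (c * a)"
proof -
  obtain A where A: "compact_op A" "\<And>x. T x = A x + a *\<^sub>C x"
    using scalar_mod_compactE[OF T] by blast
  show ?thesis
    by (rule scalar_mod_compactI[OF compact_op_scale[OF A(1), of c]])
      (rule ell2_eqI, simp add: A(2) algebra_simps)
qed

lemma scalar_mod_compact_comp:
  assumes S: "scalar_mod_compact S a" and T: "scalar_mod_compact T b"
  shows "scalar_mod_compact (S \<circ> T) (a * b)"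
proof -
  obtain A where A: "compact_op A" "\<And>x. S x = A x + a *\<^sub>C x"
    using scalar_mod_compactE[OF S] by blast
  obtain B where B: "compact_op B" "\<And>x. T x = B x + b *\<^sub>C x"
    using scalar_mod_compactE[OF T] by blast
  have "compact_op (\<lambda>x. (A \<circ> T) x + a *\<^sub>C B x)"
    by (intro compact_op_add compact_op_comp_right compact_op_scale A B
        scalar_mod_compact_bounded[OF T])
  then show ?thesis
    by (rule scalar_mod_compactI) (rule ell2_eqI, simp add: A(2), simp add: B(2) algebra_simps)
qed

lemma scalar_mod_compact_adj:
  assumes T: "scalar_mod_compact T a"
  shows "scalar_mod_compact (adj T) (cnj a)"
proof -
  obtain A where A: "compact_op A" "\<And>x. T x = A x + a *\<^sub>C x"
    using scalar_mod_compactE[OF T] by blast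
  have "adj T = (\<lambda>x. adj A x + cnj a *\<^sub>C x)"
    by (rule adj_eqI) (simp add: A(2) cinner_add_left cinner_add_right cinner_scaleC_left
        cinner_scaleC_right cinner_adj[OF compact_op_imp_bounded[OF A(1)]])
  then show ?thesis
    using compact_op_adj[OF A(1)] unfolding scalar_mod_compact_def by blast
qed

lemma scalar_mod_compact_unique:
  assumes inf: "infinite (UNIV :: 'i set)"
    and a: "scalar_mod_compact (T :: 'i ell2 \<Rightarrow> 'i ell2) a" and b: "scalar_mod_compact T b"
  shows "a = b"
proof -
  obtain A where A: "compact_op A" "\<And>x. T x = A x + a *\<^sub>C x"
    using scalar_mod_compactE[OF a] by blast
  obtain B where B: "compact_op B" "\<And>x. T x = B x + b *\<^sub>C x"
    using scalar_mod_compactE[OF b] by blast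
  have "coord (A x) i + a * coord x i = coord (B x) i + b * coord x i" for x i
    using A(2)[of x] B(2)[of x] by (metis coord_simps(2) scaleC_ell2.rep_eq)
  then have "(\<lambda>x. (a - b) *\<^sub>C x) = (\<lambda>x. B x + (-1) *\<^sub>C A x)"
    by (intro ext ell2_eqI) (simp add: algebra_simps)
  moreover have "compact_op (\<lambda>x. B x + (-1) *\<^sub>C A x)"
    by (intro compact_op_add compact_op_scale A B)
  ultimately have "compact_op (\<lambda>x :: 'i ell2. (a - b) *\<^sub>C x)"
    by (simp only:)
  then show ?thesis
    using compact_scalar_op_zero[OF inf] by fastforce
qed

lemma scalar_mod_compact_diag:
  assumes m: "(m \<longlongrightarrow> c) cofinite"
  shows "scalar_mod_compact (diag m) (complex_of_real c)"
proof (rule scalar_mod_compactI)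
  have lim: "((\<lambda>i. m i - c) \<longlongrightarrow> 0) cofinite"
    using tendsto_diff[OF m tendsto_const[of c]] by simp
  then show "compact_op (diag (\<lambda>i. m i - c))"
    by (rule compact_op_diag)
  obtain K where K: "\<And>i. \<bar>m i\<bar> \<le> K"
    using cofinite_limit_bounded[OF m] by blast
  obtain L where L: "\<And>i. \<bar>m i - c\<bar> \<le> L"
    using cofinite_limit_bounded[OF lim] by blast
  show "diag m x = diag (\<lambda>i. m i - c) x + complex_of_real c *\<^sub>C x" for x
    by (rule ell2_eqI) (simp add: coord_diag[OF K] coord_diag[OF L] algebra_simps)
qed

lemma boolean_algebra_diag: "(m \<longlongrightarrow> c) cofinite \<Longrightarrow> diag m \<in> boolean_algebra"
  using scalar_mod_compact_diag unfolding boolean_algebra_iff by blast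

lemma boolean_algebra_bounded: "T \<in> boolean_algebra \<Longrightarrow> bounded_clinear_op T"
  using scalar_mod_compact_bounded unfolding boolean_algebra_iff by blast

lemma boolean_algebra_compact: "compact_op A \<Longrightarrow> A \<in> boolean_algebra"
  using scalar_mod_compact_compact unfolding boolean_algebra_iff by blast

lemma boolean_algebra_id: "id \<in> boolean_algebra"
  using scalar_mod_compact_id unfolding boolean_algebra_iff by blast

lemma boolean_algebra_add:
  "S \<in> boolean_algebra \<Longrightarrow> T \<in> boolean_algebra \<Longrightarrow> (\<lambda>x. S x + T x) \<in> boolean_algebra"
  using scalar_mod_compact_add unfolding boolean_algebra_iff by blast

lemma boolean_algebra_scale: "T \<in> boolean_algebra \<Longrightarrow> (\<lambda>x. c *\<^sub>C T x) \<in> boolean_algebra"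
  using scalar_mod_compact_scale unfolding boolean_algebra_iff by blast

lemma boolean_algebra_comp:
  "S \<in> boolean_algebra \<Longrightarrow> T \<in> boolean_algebra \<Longrightarrow> S \<circ> T \<in> boolean_algebra"
  using scalar_mod_compact_comp unfolding boolean_algebra_iff by blast

lemma boolean_algebra_adj: "T \<in> boolean_algebra \<Longrightarrow> adj T \<in> boolean_algebra"
  using scalar_mod_compact_adj unfolding boolean_algebra_iff by blast

lemma bounded_clinear_op_perm_unitary: "bounded_clinear_op (perm_unitary g)"
proof (rule bounded_clinear_opI[where K = 1])
  fix x
  have bij: "bij (map_option (inv (apply g)))"
    by (intro bij_map_option bij_imp_bij_inv bij_apply)
  have "(norm (perm_unitary g x))\<^sup>2 = (norm x)\<^sup>2"
    unfolding norm_sq_infsum perm_unitary.rep_eq by (rule infsum_reindex_bij_betw[OF bij])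
  then show "norm (perm_unitary g x) \<le> 1 * norm x"
    by (simp add: power2_eq_iff_nonneg)
qed (auto intro!: ell2_eqI simp: perm_unitary.rep_eq)

lemma perm_action_apply: "perm_action g T x = perm_unitary g (T (perm_unitary (inverse g) x))"
  by (simp add: perm_action_def perm_unitary_adj)

lemma scalar_mod_compact_perm_action:
  assumes T: "scalar_mod_compact T a"
  shows "scalar_mod_compact (perm_action g T) a"
proof -
  obtain A where A: "compact_op A" "\<And>x. T x = A x + a *\<^sub>C x"
    using scalar_mod_compactE[OF T] by blast
  have "compact_op (perm_unitary g \<circ> (A \<circ> perm_unitary (inverse g)))"
    by (intro compact_op_comp_left compact_op_comp_right A bounded_clinear_op_perm_unitary)
  then show ?thesis
    by (rule scalar_mod_compactI)
      (simp add: perm_action_apply A(2) bop_add[OF bounded_clinear_op_perm_unitary]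
        bop_scaleC[OF bounded_clinear_op_perm_unitary] perm_unitary_inverse)
qed

lemma boolean_algebra_perm_action: "T \<in> boolean_algebra \<Longrightarrow> perm_action g T \<in> boolean_algebra"
  using scalar_mod_compact_perm_action unfolding boolean_algebra_iff by blast

lemma perm_action_proj: "perm_action g (proj {Some i}) = proj {Some (apply g i)}"
proof (intro ext ell2_eqI)
  fix x k
  have "map_option (inv (apply g)) k = Some i \<longleftrightarrow> k = Some (apply g i)"
    by (cases k) (auto simp: bij_is_inj bij_is_surj surj_f_inv_f)
  then show "coord (perm_action g (proj {Some i}) x) k = coord (proj {Some (apply g i)} x) k"
    by (auto simp: perm_action_apply perm_unitary.rep_eq inverse_perm.rep_eq inv_inv_eq)
qed

section \<open>States\<close>

context
  fixes \<omega> :: "(boolean_fock \<Rightarrow> boolean_fock) \<Rightarrow> complex"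
  assumes state: "is_state \<omega>"
begin

lemma state_add:
  "S \<in> boolean_algebra \<Longrightarrow> T \<in> boolean_algebra \<Longrightarrow> \<omega> (\<lambda>x. S x + T x) = \<omega> S + \<omega> T"
  using state unfolding is_state_def by blast

lemma state_scale: "T \<in> boolean_algebra \<Longrightarrow> \<omega> (\<lambda>x. c *\<^sub>C T x) = c * \<omega> T"
  using state unfolding is_state_def by blast

lemma state_pos: "T \<in> boolean_algebra \<Longrightarrow> \<omega> (adj T \<circ> T) \<in> \<real>\<^sub>\<ge>\<^sub>0"
  using state unfolding is_state_def by blast

lemma state_id: "\<omega> id = 1"
  using state unfolding is_state_def by blast

end

lemma affine_nonneg_imp_zero:
  assumes "\<And>t :: real. c + complex_of_real t * w \<in> \<real>\<^sub>\<ge>\<^sub>0"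
  shows "w = 0"
proof -
  have re: "0 \<le> Re c + t * Re w" and im: "Im c + t * Im w = 0" for t :: real
    using assms[of t] by (simp_all add: complex_nonneg_Reals_iff)
  have "Im w = 0"
    using im[of 0] im[of 1] by simp
  moreover have "Re w = 0"
  proof (rule ccontr)
    assume "Re w \<noteq> 0"
    then show False
      using re[of "- (Re c + 1) / Re w"] by simp
  qed
  ultimately show ?thesis
    by (simp add: complex_eq_iff)
qed

text \<open>The degenerate case of the Cauchy-Schwarz inequality: \<open>\<omega>\<close> is nonnegative on the absolute
  square of \<open>T + z S\<close> for every \<open>z\<close>, and without a quadratic term in \<open>z\<close> the linear term has to
  vanish.\<close>

lemma state_null:
  assumes \<omega>: "is_state \<omega>" and S: "S \<in> boolean_algebra" and T: "T \<in> boolean_algebra"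
    and null: "\<omega> (adj S \<circ> S) = 0"
  shows "\<omega> (adj S \<circ> T) = 0" and "\<omega> (adj T \<circ> S) = 0"
proof -
  note bS = boolean_algebra_bounded[OF S] and bT = boolean_algebra_bounded[OF T]
  define c u v where "c = \<omega> (adj T \<circ> T)" and "u = \<omega> (adj S \<circ> T)" and "v = \<omega> (adj T \<circ> S)"
  have lin: "z * v + cnj z * u = 0" for z
  proof (rule affine_nonneg_imp_zero)
    fix t :: real
    define y where "y = complex_of_real t * z"
    define W where "W = (\<lambda>x. T x + y *\<^sub>C S x)"
    have W: "W \<in> boolean_algebra"
      unfolding W_def by (intro boolean_algebra_add boolean_algebra_scale S T)
    have adjW: "adj W = (\<lambda>x. adj T x + cnj y *\<^sub>C adj S x)"
      unfolding W_def
      by (simp add: adj_add[OF bT bounded_clinear_op_scale[OF bS]] adj_scale[OF bS])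
    have "adj W \<circ> W = (\<lambda>x. ((adj T \<circ> T) x + y *\<^sub>C (adj T \<circ> S) x) +
        (cnj y *\<^sub>C (adj S \<circ> T) x + (cnj y * y) *\<^sub>C (adj S \<circ> S) x))"
      unfolding adjW unfolding W_def
      by (intro ext ell2_eqI) (simp add: bop_add[OF bounded_clinear_op_adj[OF bS]]
          bop_add[OF bounded_clinear_op_adj[OF bT]] bop_scaleC[OF bounded_clinear_op_adj[OF bS]]
          bop_scaleC[OF bounded_clinear_op_adj[OF bT]] algebra_simps)
    then have "\<omega> (adj W \<circ> W) = (c + y * v) + (cnj y * u + (cnj y * y) * 0)"
      by (simp only: c_def u_def v_def null[symmetric] state_add[OF \<omega>] state_scale[OF \<omega>]
          boolean_algebra_add boolean_algebra_scale boolean_algebra_comp boolean_algebra_adj S T)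
    then show "c + complex_of_real t * (z * v + cnj z * u) \<in> \<real>\<^sub>\<ge>\<^sub>0"
      using state_pos[OF \<omega> W] by (simp add: y_def algebra_simps)
  qed
  \<comment> \<open>The values \<open>1\<close> and \<open>\<i>\<close> of \<open>z\<close> separate \<open>u\<close> from \<open>v\<close>.\<close>
  have "v + u = 0" "\<i> * v - \<i> * u = 0"
    using lin[of 1] lin[of \<i>] by simp_all
  then have "v + u = 0" "v = u"
    by (simp_all flip: right_diff_distrib)
  then show "\<omega> (adj S \<circ> T) = 0" "\<omega> (adj T \<circ> S) = 0"
    by (simp_all add: u_def v_def)
qed

lemma state_diag_nonneg:
  assumes \<omega>: "is_state \<omega>" and m: "(m \<longlongrightarrow> c) cofinite" "\<And>i. 0 \<le> m i"
  shows "\<omega> (diag m) \<in> \<real>\<^sub>\<ge>\<^sub>0"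
proof -
  define s where "s i = sqrt (m i)" for i
  have lim: "(s \<longlongrightarrow> sqrt c) cofinite"
    unfolding s_def[abs_def] by (rule tendsto_real_sqrt[OF m(1)])
  then obtain K where K: "\<And>i. \<bar>s i\<bar> \<le> K"
    using cofinite_limit_bounded by blast
  have "(\<lambda>i. s i * s i) = m"
    by (simp add: s_def m(2) fun_eq_iff)
  then have "adj (diag s) \<circ> diag s = diag m"
    by (simp add: adj_diag[OF K] diag_comp[OF K K] fun_eq_iff)
  then show ?thesis
    using state_pos[OF \<omega> boolean_algebra_diag[OF lim]] by simp
qed

lemma state_diag_add:
  assumes \<omega>: "is_state \<omega>" and m: "(m \<longlongrightarrow> c) cofinite" and n: "(n \<longlongrightarrow> d) cofinite"
  shows "\<omega> (diag (\<lambda>i. m i + n i)) = \<omega> (diag m) + \<omega> (diag n)"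
proof -
  obtain K where K: "\<And>i. \<bar>m i\<bar> \<le> K"
    using cofinite_limit_bounded[OF m] by blast
  obtain L where L: "\<And>i. \<bar>n i\<bar> \<le> L"
    using cofinite_limit_bounded[OF n] by blast
  obtain M where M: "\<And>i. \<bar>m i + n i\<bar> \<le> M"
    using cofinite_limit_bounded[OF tendsto_add[OF m n]] by blast
  have "diag (\<lambda>i. m i + n i) = (\<lambda>x. diag m x + diag n x)"
    by (intro ext ell2_eqI) (simp add: coord_diag[OF K] coord_diag[OF L] coord_diag[OF M] algebra_simps)
  then show ?thesis
    by (simp add: state_add[OF \<omega>] boolean_algebra_diag[OF m] boolean_algebra_diag[OF n])
qed

lemma state_diag_scale:
  assumes \<omega>: "is_state \<omega>" and m: "(m \<longlongrightarrow> c) cofinite"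
  shows "\<omega> (diag (\<lambda>i. r * m i)) = complex_of_real r * \<omega> (diag m)"
proof -
  obtain K where K: "\<And>i. \<bar>m i\<bar> \<le> K"
    using cofinite_limit_bounded[OF m] by blast
  obtain M where M: "\<And>i. \<bar>r * m i\<bar> \<le> M"
    using cofinite_limit_bounded[OF tendsto_mult_left[OF m]] by blast
  have "diag (\<lambda>i. r * m i) = (\<lambda>x. complex_of_real r *\<^sub>C diag m x)"
    by (intro ext ell2_eqI) (simp add: coord_diag[OF K] coord_diag[OF M])
  then show ?thesis
    by (simp add: state_scale[OF \<omega>] boolean_algebra_diag[OF m])
qed

lemma state_diag_one:
  assumes "is_state \<omega>"
  shows "\<omega> (diag (\<lambda>i. 1)) = 1"
proof -
  have "diag (\<lambda>i. 1) = (id :: boolean_fock \<Rightarrow> boolean_fock)"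
    by (intro ext ell2_eqI) (simp add: coord_diag[where K = 1])
  then show ?thesis
    using state_id[OF assms] by (simp only:)
qed

lemma cofinite_finite_support:
  fixes f :: "'i \<Rightarrow> real"
  assumes "finite F"
  shows "((\<lambda>i. indicator F i * f i) \<longlongrightarrow> 0) cofinite"
proof (rule tendsto_eventually)
  have "{i. indicator F i * f i \<noteq> 0} \<subseteq> F"
    by (auto simp: indicator_def)
  then show "\<forall>\<^sub>F i in cofinite. indicator F i * f i = 0"
    unfolding eventually_cofinite using assms by (rule finite_subset)
qed

lemma indicator_tendsto_cofinite: "finite F \<Longrightarrow> (indicator F \<longlongrightarrow> (0 :: real)) cofinite"
  using cofinite_finite_support[of F "\<lambda>_. 1"] by simp

lemma state_diag_finite_support:
  assumes \<omega>: "is_state \<omega>" and "finite F"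
  shows "\<omega> (diag (\<lambda>i. indicator F i * f i)) = (\<Sum>i\<in>F. complex_of_real (f i) * \<omega> (proj {i}))"
  using \<open>finite F\<close>
proof induction
  case empty
  then show ?case
    using state_diag_scale[OF \<omega> indicator_tendsto_cofinite[of "{}"], of 0] by simp
next
  case (insert k F)
  have "(\<lambda>i. indicator (insert k F) i * f i) = (\<lambda>i. f k * indicator {k} i + indicator F i * f i)"
    using insert.hyps by (auto simp: indicator_def)
  moreover have "((\<lambda>i. f k * indicator {k} i) \<longlongrightarrow> 0) cofinite"
    using tendsto_mult_left[OF indicator_tendsto_cofinite[of "{k}"], of "f k"] by simp
  ultimately show ?case
    using insert by (simp add: state_diag_add[OF \<omega> _ cofinite_finite_support]
        state_diag_scale[OF \<omega> indicator_tendsto_cofinite])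
qed

section \<open>Symmetric states\<close>

text \<open>Arbitrarily many mutually orthogonal projections of the same expectation add up to at most
  the identity.\<close>

lemma symmetric_state_proj_zero:
  assumes "\<omega> \<in> symmetric_states"
  shows "\<omega> (proj {Some i}) = 0"
proof -
  have \<omega>: "is_state \<omega>"
    using assms by (simp add: symmetric_states_def)
  define p where "p = \<omega> (proj {Some i})"
  have same: "\<omega> (proj {Some j}) = p" for j
  proof -
    have "\<omega> (perm_action (Perm.swap i j) (proj {Some i})) = \<omega> (proj {Some i})"
      using assms boolean_algebra_diag[OF indicator_tendsto_cofinite[of "{Some i}"]]
      by (simp add: symmetric_states_def)
    then show ?thesis
      by (simp add: perm_action_proj p_def)
  qed
  have pos: "p \<in> \<real>\<^sub>\<ge>\<^sub>0"
    unfolding p_def by (rule state_diag_nonneg[OF \<omega> indicator_tendsto_cofinite]) auto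
  have "real n * Re p \<le> 1" for n
  proof -
    define F where "F = (\<lambda>k. Some (int k)) ` {..<n}"
    have F: "finite F" "card F = n"
      by (auto simp: F_def card_image inj_on_def)
    let ?f = "\<lambda>i. indicator F i * (-1 :: real)"
    have "\<omega> (diag (\<lambda>i. 1 + ?f i)) = \<omega> (diag (\<lambda>i. 1)) + \<omega> (diag ?f)"
      by (rule state_diag_add[OF \<omega> tendsto_const cofinite_finite_support[OF F(1)]])
    also have "\<omega> (diag ?f) = (\<Sum>i\<in>F. - p)"
      unfolding state_diag_finite_support[OF \<omega> F(1)] by (rule sum.cong) (auto simp: F_def same)
    finally have "\<omega> (diag (\<lambda>i. 1 + ?f i)) = 1 - of_nat n * p"
      by (simp add: state_diag_one[OF \<omega>] F(2))
    moreover have "\<omega> (diag (\<lambda>i. 1 + ?f i)) \<in> \<real>\<^sub>\<ge>\<^sub>0"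
      by (rule state_diag_nonneg[OF \<omega> tendsto_add[OF tendsto_const cofinite_finite_support[OF F(1)]]])
        (auto simp: indicator_def)
    ultimately show ?thesis
      by (simp add: complex_nonneg_Reals_iff)
  qed
  then have "\<not> 0 < Re p"
    using reals_Archimedean3[of "Re p"] by (meson not_less)
  then have "p = 0"
    using pos by (auto simp: complex_nonneg_Reals_iff complex_eq_iff)
  then show ?thesis
    by (simp add: p_def)
qed

text \<open>Up to finitely many coordinates, where \<open>\<omega>\<close> vanishes, \<open>d\<close> is dominated by an arbitrarily
  small constant.\<close>

lemma symmetric_state_null_diag:
  assumes sym: "\<omega> \<in> symmetric_states"
    and d: "(d \<longlongrightarrow> 0) cofinite" "\<And>i. 0 \<le> d i" "d None = 0"
  shows "\<omega> (diag d) = 0"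
proof -
  have \<omega>: "is_state \<omega>"
    using sym by (simp add: symmetric_states_def)
  have "Re (\<omega> (diag d)) \<le> 0 + e" if e: "0 < e" for e
  proof -
    define F where "F = {i. \<not> dist (d i) 0 < e}"
    have F: "finite F"
      using tendstoD[OF d(1) e] by (simp add: F_def eventually_cofinite)
    have fin: "\<omega> (diag (\<lambda>i. indicator F i * d i)) = 0"
      unfolding state_diag_finite_support[OF \<omega> F]
    proof (rule sum.neutral, rule ballI)
      fix i assume "i \<in> F"
      then obtain j where "i = Some j"
        using d(3) e by (cases i) (auto simp: F_def)
      then show "complex_of_real (d i) * \<omega> (proj {i}) = 0"
        by (simp add: symmetric_state_proj_zero[OF sym])
    qed
    let ?m = "\<lambda>i. (e * 1 + (-1) * d i) + indicator F i * d i"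
    have lim1: "((\<lambda>i. e * 1) \<longlongrightarrow> e * 1) (cofinite :: int option filter)"
      and lim2: "((\<lambda>i. (-1) * d i) \<longlongrightarrow> (-1) * 0) cofinite"
      by (rule tendsto_const, rule tendsto_mult_left[OF d(1)])
    note lim3 = cofinite_finite_support[OF F, of d]
    have "0 \<le> ?m i" for i
      using d(2)[of i] e by (auto simp: F_def indicator_def dist_real_def)
    then have "\<omega> (diag ?m) \<in> \<real>\<^sub>\<ge>\<^sub>0"
      by (rule state_diag_nonneg[OF \<omega> tendsto_add[OF tendsto_add[OF lim1 lim2] lim3]])
    also have "\<omega> (diag ?m) = complex_of_real e * 1 + (- 1) * \<omega> (diag d) + 0"
      using state_diag_scale[OF \<omega> tendsto_const, of e 1] state_diag_scale[OF \<omega> d(1), of "-1"]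
      unfolding state_diag_add[OF \<omega> tendsto_add[OF lim1 lim2] lim3]
        state_diag_add[OF \<omega> lim1 lim2] fin
      by (simp add: state_diag_one[OF \<omega>])
    finally show ?thesis
      by (simp add: complex_nonneg_Reals_iff)
  qed
  then have "Re (\<omega> (diag d)) \<le> 0"
    by (rule field_le_epsilon)
  moreover have "\<omega> (diag d) \<in> \<real>\<^sub>\<ge>\<^sub>0"
    by (rule state_diag_nonneg[OF \<omega> d(1) d(2)])
  ultimately show ?thesis
    by (simp add: complex_nonneg_Reals_iff complex_eq_iff)
qed

text \<open>Off the vacuum a compact operator factors through a diagonal operator whose square is
  annihilated by \<open>\<omega>\<close>, and then so is the operator itself.\<close>

lemma symmetric_state_off_vacuum:
  assumes sym: "\<omega> \<in> symmetric_states" and A: "compact_op A"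
  shows "\<omega> (proj (- {None}) \<circ> A) = 0" and "\<omega> (A \<circ> proj (- {None})) = 0"
proof -
  let ?R = "proj (- {None}) :: boolean_fock \<Rightarrow> boolean_fock"
  have \<omega>: "is_state \<omega>"
    using sym by (simp add: symmetric_states_def)
  have R: "bounded_clinear_op ?R"
    by (rule bounded_clinear_op_proj)
  have adjR: "adj ?R = ?R"
    by (rule adj_diag[where K = 1]) (simp add: indicator_def)
  have key: "\<omega> (?R \<circ> C) = 0 \<and> \<omega> (adj (?R \<circ> C)) = 0" if C: "compact_op C" for C
  proof -
    obtain d B where d: "\<And>i. 0 \<le> d i" "(d \<longlongrightarrow> 0) cofinite" and B: "compact_op B"
      and CB: "C = diag d \<circ> B"
      using compact_op_factorization[OF C] by blast
    define s where "s i = indicator (- {None}) i * d i" for i :: "int option"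
    have slim: "(s \<longlongrightarrow> 0) cofinite"
      by (rule tendsto_sandwich[OF _ _ tendsto_const d(2)])
        (auto intro!: always_eventually simp: s_def indicator_def d(1))
    obtain K where K: "\<And>i. \<bar>d i\<bar> \<le> K"
      using cofinite_limit_bounded[OF d(2)] by blast
    obtain L where L: "\<And>i. \<bar>s i\<bar> \<le> L"
      using cofinite_limit_bounded[OF slim] by blast
    have "?R \<circ> C = (\<lambda>x. ?R (diag d (B x)))"
      by (simp add: CB o_def)
    also have "\<dots> = diag s \<circ> B"
      by (simp add: diag_comp[where K = 1, OF _ K] indicator_def s_def[abs_def] o_def)
    finally have RC: "?R \<circ> C = adj (diag s) \<circ> B"
      by (simp add: adj_diag[OF L])
    have "adj (diag s) \<circ> diag s = diag (\<lambda>i. s i * s i)"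
      by (simp add: adj_diag[OF L] diag_comp[OF L L] fun_eq_iff)
    moreover have "\<omega> (diag (\<lambda>i. s i * s i)) = 0"
      using tendsto_mult[OF slim slim]
      by (intro symmetric_state_null_diag[OF sym]) (auto simp: s_def)
    ultimately have null: "\<omega> (adj (diag s) \<circ> diag s) = 0"
      by simp
    note mem = boolean_algebra_diag[OF slim] boolean_algebra_compact[OF B]
    have adjRC: "adj (?R \<circ> C) = adj B \<circ> diag s"
      unfolding RC
      by (simp add: adj_comp adj_adj bounded_clinear_op_adj boolean_algebra_bounded[OF mem(1)]
          boolean_algebra_bounded[OF mem(2)])
    show ?thesis
    proof
      show "\<omega> (?R \<circ> C) = 0"
        unfolding RC by (rule state_null(1)[OF \<omega> mem null])
      show "\<omega> (adj (?R \<circ> C)) = 0"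
        unfolding adjRC by (rule state_null(2)[OF \<omega> mem null])
    qed
  qed
  show "\<omega> (?R \<circ> A) = 0"
    using key[OF A] by blast
  have bA: "bounded_clinear_op A"
    using A by (rule compact_op_imp_bounded)
  have "adj (?R \<circ> adj A) = A \<circ> ?R"
    by (simp add: adj_comp[OF R bounded_clinear_op_adj[OF bA]] adj_adj[OF bA] adjR)
  then show "\<omega> (A \<circ> ?R) = 0"
    using key[OF compact_op_adj[OF A]] by simp
qed

text \<open>What remains of a compact operator is its vacuum matrix entry.\<close>

lemma symmetric_state_compact:
  assumes sym: "\<omega> \<in> symmetric_states" and A: "compact_op A"
  shows "\<omega> A = cinner (A (basis_vec None)) (basis_vec None) * \<omega> (proj {None})"
proof -
  let ?P = "proj {None} :: boolean_fock \<Rightarrow> boolean_fock"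
  let ?R = "proj (- {None}) :: boolean_fock \<Rightarrow> boolean_fock"
  let ?c = "cinner (A (basis_vec None)) (basis_vec None)"
  have \<omega>: "is_state \<omega>"
    using sym by (simp add: symmetric_states_def)
  have bA: "bounded_clinear_op A"
    using A by (rule compact_op_imp_bounded)
  have PA: "compact_op (?P \<circ> A)" and RA: "compact_op (?R \<circ> A)"
    using compact_op_comp_left[OF A bounded_clinear_op_proj] by blast+
  then have PAR: "compact_op (?P \<circ> A \<circ> ?R)"
    using compact_op_comp_right bounded_clinear_op_proj by blast
  have P: "?P \<in> boolean_algebra"
    by (rule boolean_algebra_diag[OF indicator_tendsto_cofinite]) simp
  have vac: "?P x = coord x None *\<^sub>C basis_vec None" for x
    using proj_finite[of "{None}" x] by simp
  have corner: "?P (A (?P x)) = ?c *\<^sub>C ?P x" for x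
    by (simp only: vac bop_scaleC[OF bA] cinner_basis_right scaleC_ell2.rep_eq scaleC_scaleC
        mult.commute)
  have "A x = (?R \<circ> A) x + ((?P \<circ> A \<circ> ?R) x + ?c *\<^sub>C ?P x)" for x
  proof -
    have "A x = ?R (A x) + ?P (A x)"
      using proj_plus_complement[of "{None}" "A x"] by (simp add: add.commute)
    also have "?P (A x) = ?P (A (?R x)) + ?P (A (?P x))"
      using proj_plus_complement[of "{None}" x]
      by (metis add.commute bop_add[OF bA] bop_add[OF bounded_clinear_op_proj])
    finally show ?thesis
      by (simp add: corner)
  qed
  then have "\<omega> A = \<omega> (\<lambda>x. (?R \<circ> A) x + ((?P \<circ> A \<circ> ?R) x + ?c *\<^sub>C ?P x))"
    by (intro arg_cong[where f = \<omega>] ext)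
  also have "\<dots> = \<omega> (?R \<circ> A) + (\<omega> (?P \<circ> A \<circ> ?R) + ?c * \<omega> ?P)"
    by (simp only: state_add[OF \<omega>] state_scale[OF \<omega>] boolean_algebra_add boolean_algebra_scale
        boolean_algebra_compact[OF RA] boolean_algebra_compact[OF PAR] P)
  finally show ?thesis
    by (simp add: symmetric_state_off_vacuum[OF sym A] symmetric_state_off_vacuum[OF sym PA])
qed

section \<open>The segment of symmetric states\<close>

lemma state_at_infinity_eq:
  fixes T :: "boolean_fock \<Rightarrow> boolean_fock"
  assumes "scalar_mod_compact T a"
  shows "state_at_infinity T = a"
proof -
  have "(THE b. scalar_mod_compact T b) = a"
  proof (rule the_equality)
    show "scalar_mod_compact T a"
      by (rule assms)
    fix b assume b: "scalar_mod_compact T b"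
    have "infinite (UNIV :: int option set)"
      by (simp add: infinite_UNIV_int)
    then show "b = a"
      using b assms by (rule scalar_mod_compact_unique)
  qed
  moreover have "T \<in> boolean_algebra"
    using assms boolean_algebra_iff by blast
  ultimately show ?thesis
    by (simp add: state_at_infinity_def scalar_mod_compact_def)
qed

lemma vacuum_state_eq:
  "T \<in> boolean_algebra \<Longrightarrow> vacuum_state T = cinner (T (basis_vec None)) (basis_vec None)"
  by (simp add: vacuum_state_def)

lemma vacuum_state_symmetric: "vacuum_state \<in> symmetric_states"
proof -
  have pos: "vacuum_state (adj T \<circ> T) \<in> \<real>\<^sub>\<ge>\<^sub>0" if T: "T \<in> boolean_algebra" for T
  proof -
    have "vacuum_state (adj T \<circ> T) = cinner (T (basis_vec None)) (T (basis_vec None))"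
      using cinner_adj'[OF bounded_clinear_op_adj[OF boolean_algebra_bounded[OF T]],
          of "T (basis_vec None)" "basis_vec None"]
        cinner_adj[OF bounded_clinear_op_adj[OF boolean_algebra_bounded[OF T]]]
      by (simp add: vacuum_state_eq boolean_algebra_comp boolean_algebra_adj T
          adj_adj[OF boolean_algebra_bounded[OF T]])
    then show ?thesis
      by (simp only: cinner_self nonneg_Reals_of_real_iff zero_le_power2)
  qed
  have inv: "vacuum_state (perm_action g T) = vacuum_state T" if T: "T \<in> boolean_algebra" for g T
  proof -
    have "cinner (perm_unitary g (T (basis_vec None))) (basis_vec None)
        = cinner (T (basis_vec None)) (basis_vec None)"
      by (subst cinner_adj[OF bounded_clinear_op_perm_unitary])
        (simp add: perm_unitary_adj perm_unitary_vacuum)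
    then show ?thesis
      by (simp add: vacuum_state_eq boolean_algebra_perm_action T perm_action_apply perm_unitary_vacuum)
  qed
  have "vacuum_state \<in> extensional boolean_algebra"
    by (simp add: vacuum_state_def)
  moreover have "vacuum_state id = 1"
    by (simp add: vacuum_state_eq boolean_algebra_id cinner_self)
  ultimately show ?thesis
    unfolding symmetric_states_def is_state_def
    by (auto simp: pos inv vacuum_state_eq boolean_algebra_add boolean_algebra_scale
        cinner_add_left cinner_scaleC_left simp del: o_apply)
qed

lemma state_at_infinity_symmetric: "state_at_infinity \<in> symmetric_states"
proof -
  have ex: "\<exists>a. scalar_mod_compact T a \<and> state_at_infinity T = a" if "T \<in> boolean_algebra" for T
    using that state_at_infinity_eq boolean_algebra_iff by blast
  have pos: "state_at_infinity (adj T \<circ> T) \<in> \<real>\<^sub>\<ge>\<^sub>0" if T: "T \<in> boolean_algebra" for T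
  proof -
    obtain a where "scalar_mod_compact T a"
      using ex[OF T] by blast
    then have "state_at_infinity (adj T \<circ> T) = cnj a * a"
      by (intro state_at_infinity_eq scalar_mod_compact_comp scalar_mod_compact_adj)
    also have "\<dots> = complex_of_real ((cmod a)\<^sup>2)"
      by (simp only: complex_norm_square mult.commute)
    finally show ?thesis
      by (simp only: nonneg_Reals_of_real_iff zero_le_power2)
  qed
  have add: "state_at_infinity (\<lambda>x. S x + T x) = state_at_infinity S + state_at_infinity T"
    if "S \<in> boolean_algebra" "T \<in> boolean_algebra" for S T
    using ex[OF that(1)] ex[OF that(2)] scalar_mod_compact_add state_at_infinity_eq by blast
  have scale: "state_at_infinity (\<lambda>x. c *\<^sub>C T x) = c * state_at_infinity T"
    if "T \<in> boolean_algebra" for c T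
    using ex[OF that] scalar_mod_compact_scale state_at_infinity_eq by blast
  have inv: "state_at_infinity (perm_action g T) = state_at_infinity T"
    if "T \<in> boolean_algebra" for g T
    using ex[OF that] scalar_mod_compact_perm_action state_at_infinity_eq by blast
  have "state_at_infinity \<in> extensional boolean_algebra"
    by (simp add: state_at_infinity_def)
  moreover have "state_at_infinity id = 1"
    by (rule state_at_infinity_eq[OF scalar_mod_compact_id])
  ultimately show ?thesis
    unfolding symmetric_states_def is_state_def by (auto simp: pos add scale inv simp del: o_apply)
qed

lemma mix_symmetric:
  assumes \<phi>: "\<phi> \<in> symmetric_states" and \<psi>: "\<psi> \<in> symmetric_states" and \<gamma>: "\<gamma> \<in> {0..1}"
  shows "mix \<gamma> \<phi> \<psi> \<in> symmetric_states"
proof -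
  have s: "is_state \<phi>" "is_state \<psi>"
    using \<phi> \<psi> by (simp_all add: symmetric_states_def)
  have eq: "mix \<gamma> \<phi> \<psi> T = complex_of_real \<gamma> * \<phi> T + complex_of_real (1 - \<gamma>) * \<psi> T"
    if "T \<in> boolean_algebra" for T
    using that by (simp add: mix_def)
  have pos: "mix \<gamma> \<phi> \<psi> (adj T \<circ> T) \<in> \<real>\<^sub>\<ge>\<^sub>0" if T: "T \<in> boolean_algebra" for T
  proof -
    have "complex_of_real \<gamma> \<in> \<real>\<^sub>\<ge>\<^sub>0" "complex_of_real (1 - \<gamma>) \<in> \<real>\<^sub>\<ge>\<^sub>0"
      unfolding nonneg_Reals_of_real_iff using \<gamma> by auto
    then show ?thesis
      unfolding eq[OF boolean_algebra_comp[OF boolean_algebra_adj[OF T] T]]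
      using state_pos[OF s(1) T] state_pos[OF s(2) T]
      by (intro nonneg_Reals_add_I nonneg_Reals_mult_I)
  qed
  have inv: "mix \<gamma> \<phi> \<psi> (perm_action g T) = mix \<gamma> \<phi> \<psi> T" if T: "T \<in> boolean_algebra" for g T
    unfolding eq[OF T] eq[OF boolean_algebra_perm_action[OF T]]
    using \<phi> \<psi> T by (simp add: symmetric_states_def)
  have add: "mix \<gamma> \<phi> \<psi> (\<lambda>x. S x + T x) = mix \<gamma> \<phi> \<psi> S + mix \<gamma> \<phi> \<psi> T"
    if S: "S \<in> boolean_algebra" and T: "T \<in> boolean_algebra" for S T
    unfolding eq[OF S] eq[OF T] eq[OF boolean_algebra_add[OF S T]]
    by (simp add: state_add[OF s(1) S T] state_add[OF s(2) S T] algebra_simps)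
  have scale: "mix \<gamma> \<phi> \<psi> (\<lambda>x. c *\<^sub>C T x) = c * mix \<gamma> \<phi> \<psi> T"
    if T: "T \<in> boolean_algebra" for c T
    unfolding eq[OF T] eq[OF boolean_algebra_scale[OF T]]
    by (simp add: state_scale[OF s(1) T] state_scale[OF s(2) T] algebra_simps)
  have "mix \<gamma> \<phi> \<psi> id = 1"
    by (simp add: eq boolean_algebra_id state_id s)
  moreover have "mix \<gamma> \<phi> \<psi> \<in> extensional boolean_algebra"
    by (simp add: mix_def)
  ultimately show ?thesis
    unfolding symmetric_states_def is_state_def by (auto simp: pos add scale inv simp del: o_apply)
qed

text \<open>The weight of the vacuum is the expectation of the vacuum projection.\<close>

lemma symmetric_state_eq_mix:
  assumes sym: "\<omega> \<in> symmetric_states"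
  obtains \<gamma> where "\<gamma> \<in> {0..1}" "\<omega> = mix \<gamma> vacuum_state state_at_infinity"
proof -
  have \<omega>: "is_state \<omega>"
    using sym by (simp add: symmetric_states_def)
  define \<gamma> where "\<gamma> = Re (\<omega> (proj {None}))"
  have lim: "(indicator {None :: int option} \<longlongrightarrow> (0 :: real)) cofinite"
    by (rule indicator_tendsto_cofinite) simp
  have "\<omega> (proj {None}) \<in> \<real>\<^sub>\<ge>\<^sub>0"
    by (rule state_diag_nonneg[OF \<omega> lim]) auto
  then have g0: "0 \<le> \<gamma>" "\<omega> (proj {None}) = complex_of_real \<gamma>"
    by (auto simp: \<gamma>_def complex_nonneg_Reals_iff complex_eq_iff)
  have lim': "((\<lambda>i. (-1) * indicator {None :: int option} i) \<longlongrightarrow> (-1) * (0 :: real)) cofinite"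
    by (rule tendsto_mult_left[OF lim])
  have "\<omega> (diag (\<lambda>i. 1 + (-1) * indicator {None} i)) = 1 - complex_of_real \<gamma>"
    unfolding state_diag_add[OF \<omega> tendsto_const lim'] state_diag_scale[OF \<omega> lim]
    by (simp add: state_diag_one[OF \<omega>] g0(2))
  moreover have "\<omega> (diag (\<lambda>i. 1 + (-1) * indicator {None} i)) \<in> \<real>\<^sub>\<ge>\<^sub>0"
    by (rule state_diag_nonneg[OF \<omega> tendsto_add[OF tendsto_const lim']]) (auto simp: indicator_def)
  ultimately have g1: "\<gamma> \<le> 1"
    by (simp add: complex_nonneg_Reals_iff)
  have "\<omega> T = mix \<gamma> vacuum_state state_at_infinity T" if T: "T \<in> boolean_algebra" for T
  proof -
    obtain a where a: "scalar_mod_compact T a"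
      using T boolean_algebra_iff by blast
    obtain A where A: "compact_op A" "\<And>x. T x = A x + a *\<^sub>C x"
      using scalar_mod_compactE[OF a] by blast
    let ?c = "cinner (A (basis_vec None)) (basis_vec None)"
    have "T = (\<lambda>x. A x + a *\<^sub>C id x)"
      by (simp add: A(2) fun_eq_iff)
    then have "\<omega> T = \<omega> A + a * \<omega> id"
      by (simp only: state_add[OF \<omega>] state_scale[OF \<omega>] boolean_algebra_compact[OF A(1)]
          boolean_algebra_scale boolean_algebra_id)
    then have "\<omega> T = ?c * complex_of_real \<gamma> + a"
      by (simp add: symmetric_state_compact[OF sym A(1)] g0(2) state_id[OF \<omega>])
    moreover have "vacuum_state T = ?c + a"
      by (simp add: vacuum_state_eq[OF T] A(2) cinner_add_left cinner_scaleC_left cinner_self)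
    ultimately show ?thesis
      using T by (simp add: mix_def state_at_infinity_eq[OF a] algebra_simps)
  qed
  then have "\<omega> = mix \<gamma> vacuum_state state_at_infinity"
    using \<omega> by (intro extensionalityI[where A = boolean_algebra]) (auto simp: is_state_def mix_def)
  with g0(1) g1 that show thesis
    by auto
qed

theorem proposition7p3:
  shows "compactin weak_star_topology symmetric_states
    \<and> (\<forall>\<phi>\<in>symmetric_states. \<forall>\<psi>\<in>symmetric_states. \<forall>\<gamma>\<in>{0..1}. mix \<gamma> \<phi> \<psi> \<in> symmetric_states)
    \<and> symmetric_states = {mix \<gamma> vacuum_state state_at_infinity |\<gamma>. \<gamma> \<in> {0..1}}"
proof (intro conjI)
  show eq: "symmetric_states = {mix \<gamma> vacuum_state state_at_infinity |\<gamma>. \<gamma> \<in> {0..1}}"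
    using mix_symmetric[OF vacuum_state_symmetric state_at_infinity_symmetric]
      symmetric_state_eq_mix by blast
  have "continuous_map euclideanreal weak_star_topology
      (\<lambda>\<gamma>. mix \<gamma> vacuum_state state_at_infinity)"
    unfolding weak_star_topology_def continuous_map_componentwise
    by (auto simp: mix_def intro!: continuous_intros)
  then have "compactin weak_star_topology ((\<lambda>\<gamma>. mix \<gamma> vacuum_state state_at_infinity) ` {0..1})"
    by (rule image_compactin[rotated]) simp
  moreover have "(\<lambda>\<gamma>. mix \<gamma> vacuum_state state_at_infinity) ` {0..1} = symmetric_states"
    unfolding eq by blast
  ultimately show "compactin weak_star_topology symmetric_states"
    by simp
qed (use mix_symmetric in blast)

end
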